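(* Let $X$ be an infinite dimensional complex Banach space and let $T \in L(X)$. Then (i) $\mathrm{iso}\, \sigma_{ap}(T) \subset \mathrm{iso}\, \sigma(T) \cup \mathrm{int}\, \sigma_{desc}(T)$; (ii) $\mathrm{iso}\, \sigma_{su}(T) \subset \mathrm{iso}\, \sigma(T) \cup \mathrm{int}\, \sigma_{LD}(T)$; (iii) $\mathrm{iso}\, \sigma_{uw}(T) \subset \mathrm{iso}\, \sigma_b(T) \cup \mathrm{int}\, \sigma_{desc}(T)$; (iv) $\mathrm{iso}\, \sigma_{lw}(T) \subset \mathrm{iso}\, \sigma_b(T) \cup \mathrm{int}\, \sigma_{LD}(T)$; (v) $\sigma(T)=\sigma_{ap}(T) \cup \mathrm{int}\, \sigma_{desc}(T)$; (vi) $\sigma(T)=\sigma_{su}(T) \cup \mathrm{int}\, \sigma_{LD}(T)$; (vii) $\sigma_b(T)=\sigma_{uw}(T) \cup \mathrm{int}\, \sigma_{desc}(T)$; (viii) $\sigma_b(T)=\sigma_{lw}(T) \cup \mathrm{int}\, \sigma_{LD}(T)$.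
   Context: $L(X)$ is the algebra of bounded linear operators on $X$, and $\sigma(T)$ is the spectrum of $T$. For $F\subset\mathbb{C}$, $\mathrm{iso}\,F$ and $\mathrm{int}\,F$ are the set of isolated points and the interior of $F$. For $S\in L(X)$, $N(S)$ and $R(S)$ are the null space and range, $\alpha(S)=\dim N(S)$, $\beta(S)=\mathrm{codim}\,R(S)$. $S$ is bounded below if it is injective with closed range. $S$ is upper semi-Fredholm (resp. lower semi-Fredholm, Fredholm) if $R(S)$ is closed and $\alpha(S)<\infty$ (resp. $\beta(S)<\infty$; both finite); $\mathrm{ind}(S)=\alpha(S)-\beta(S)$. $S$ is upper semi-Weyl if it is upper semi-Fredholm with $\mathrm{ind}(S)\le 0$, and lower semi-Weyl if it is lower semi-Fredholm with $\mathrm{ind}(S)\ge 0$. The ascent $p(S)$ is the smallest integer $p\ge 0$ with $N(S^p)=N(S^{p+1})$ ($\infty$ if none exists); the descent $q(S)$ is the smallest integer $q\ge 0$ with $R(S^q)=R(S^{q+1})$ ($\infty$ if none exists). $S$ is Browder if it is Fredholm with $p(S)<\infty$ and $q(S)<\infty$. $S$ is left Drazin invertible if $p=p(S)<\infty$ and $R(S^{p+1})$ is closed. The spectra are the sets of $\lambda\in\mathbb{C}$ such that: $T-\lambda I$ is not bounded below ($\sigma_{ap}(T)$); $R(T-\lambda I)\ne X$ ($\sigma_{su}(T)$); $T-\lambda I$ is not upper semi-Weyl ($\sigma_{uw}(T)$); $T-\lambda I$ is not lower semi-Weyl ($\sigma_{lw}(T)$); $T-\lambda I$ is not Browder ($\sigma_b(T)$);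 $q(T-\lambda I)=\infty$ ($\sigma_{desc}(T)$); $T-\lambda I$ is not left Drazin invertible ($\sigma_{LD}(T)$). *)

theory Defs
  imports "HOL-Analysis.Analysis"
begin

text \<open>
  The library has only real Banach spaces (class \<open>banach\<close>).  A complex Banach space is a real one
  with a complex scalar multiplication that extends the real one and for which the norm is
  homogeneous over the complex numbers.
\<close>

class complex_banach = banach +
  fixes scaleC :: "complex \<Rightarrow> 'a \<Rightarrow> 'a"  (infixr \<open>*\<^sub>C\<close> 75)
  assumes scaleC_add_right: "a *\<^sub>C (x + y) = a *\<^sub>C x + a *\<^sub>C y"
    and scaleC_add_left: "(a + b) *\<^sub>C x = a *\<^sub>C x + b *\<^sub>C x"
    and scaleC_scaleC: "a *\<^sub>C b *\<^sub>C x = (a * b) *\<^sub>C x"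
    and scaleC_complex_of_real: "complex_of_real r *\<^sub>C x = r *\<^sub>R x"
    and norm_scaleC: "norm (a *\<^sub>C x) = cmod a * norm x"

lemma scaleC_one [simp]: "1 *\<^sub>C x = (x :: 'a :: complex_banach)"
  using scaleC_complex_of_real[of 1 x] by simp

global_interpretation cvs: vector_space "scaleC :: complex \<Rightarrow> 'a \<Rightarrow> 'a :: complex_banach"
  by unfold_locales (simp_all add: scaleC_add_right scaleC_add_left scaleC_scaleC)

text \<open>
  Dimension over the complex numbers of a linear subspace, with value \<open>\<infinity>\<close> when there is no finite
  spanning set (the library's \<open>dim\<close> is \<open>0\<close> there).
\<close>

definition cdim :: "'a :: complex_banach set \<Rightarrow> enat" where
  "cdim V = (if \<exists>B. finite B \<and> V \<subseteq> cvs.span B then enat (cvs.dim V) else \<infinity>)"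

text \<open>
  Codimension, i.e. the dimension of the quotient by \<open>V\<close>, as the dimension of an arbitrary
  algebraic complement of \<open>V\<close>.  That complements exist and all have the same dimension is shown
  in \<open>ccomplement_exists\<close> and \<open>ccodim_eq\<close>.
\<close>

definition ccomplement :: "'a :: complex_banach set \<Rightarrow> 'a set \<Rightarrow> bool" where
  "ccomplement V W \<longleftrightarrow> cvs.subspace W \<and> V \<inter> W = {0} \<and> {v + w |v w. v \<in> V \<and> w \<in> W} = UNIV"

definition ccodim :: "'a :: complex_banach set \<Rightarrow> enat" where
  "ccodim V = (THE d. \<exists>W. ccomplement V W \<and> d = cdim W)"

lemma ccomplement_exists:
  fixes V :: "'a :: complex_banach set"
  assumes V: "cvs.subspace V"
  shows "\<exists>W. ccomplement V W"
proof -
  obtain A where A: "A \<subseteq> V" "cvs.independent A" "V \<subseteq> cvs.span A"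
    using cvs.maximal_independent_subset by metis
  obtain B where B: "A \<subseteq> B" "cvs.independent B" "UNIV \<subseteq> cvs.span B"
    using cvs.maximal_independent_subset_extend[OF subset_UNIV A(2)] by metis
  have VA: "V = cvs.span A"
    using A V cvs.span_minimal by blast
  have BA: "A \<union> (B - A) = B"
    using B(1) by blast
  have "v = 0" if v: "v \<in> cvs.span A" "v \<in> cvs.span (B - A)" for v
  proof -
    have "cvs.representation B v = cvs.representation A v"
      "cvs.representation B v = cvs.representation (B - A) v"
      using v B by (auto intro: cvs.representation_extend)
    then have "cvs.representation B v b = 0" for b
      by (metis Diff_iff cvs.representation_ne_zero)
    then show ?thesis
      using cvs.sum_nonzero_representation_eq[OF B(2), of v] B(3) by auto
  qed
  then have "V \<inter> cvs.span (B - A) = {0}"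
    unfolding VA using cvs.span_zero by blast
  moreover have "{v + w |v w. v \<in> V \<and> w \<in> cvs.span (B - A)} = UNIV"
    unfolding VA using cvs.span_Un[of A "B - A"] BA B(3) by auto
  ultimately show ?thesis
    unfolding ccomplement_def using cvs.subspace_span by blast
qed

lemma cdim_ccomplement_le:
  fixes V :: "'a :: complex_banach set"
  assumes V: "cvs.subspace V" and W1: "ccomplement V W1" and W2: "ccomplement V W2"
  shows "cdim W1 \<le> cdim W2"
proof (cases "\<exists>C. finite C \<and> W2 \<subseteq> cvs.span C")
  case False
  then have "cdim W2 = \<infinity>" unfolding cdim_def by (rule if_not_P)
  then show ?thesis by simp
next
  case True
  then obtain C where C: "finite C" "W2 \<subseteq> cvs.span C" by blast
  have S: "cvs.subspace W1" "cvs.subspace W2"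
    using W1 W2 by (auto simp: ccomplement_def)
  have "\<exists>w. w \<in> W2 \<and> x - w \<in> V" for x
  proof -
    have "x \<in> {v + w |v w. v \<in> V \<and> w \<in> W2}"
      using W2 by (simp add: ccomplement_def)
    then show ?thesis by auto
  qed
  then obtain p where p: "\<And>x. p x \<in> W2" "\<And>x. x - p x \<in> V" by metis
  have uniq: "p x = u" if "u \<in> W2" "x - u \<in> V" for x u
  proof -
    have "p x - u \<in> W2" using p that S cvs.subspace_diff by blast
    moreover have "(x - u) - (x - p x) \<in> V" using p that V cvs.subspace_diff by blast
    ultimately have "p x - u \<in> V \<inter> W2" by simp
    then have "p x - u = 0" using W2 unfolding ccomplement_def by blast
    then show ?thesis by simp
  qed
  interpret P: vector_space_pair "scaleC :: complex \<Rightarrow> 'a \<Rightarrow> 'a" "scaleC :: complex \<Rightarrow> 'a \<Rightarrow> 'a" ..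
  have lin: "Vector_Spaces.linear scaleC scaleC p"
    unfolding Vector_Spaces.linear_iff
  proof (intro conjI allI)
    fix x y
    have "(x - p x) + (y - p y) \<in> V" using p V cvs.subspace_add by blast
    then show "p (x + y) = p x + p y"
      by (intro uniq) (simp_all add: p S cvs.subspace_add algebra_simps)
  next
    fix c x
    have "c *\<^sub>C (x - p x) \<in> V" using p V cvs.subspace_scale by blast
    then show "p (c *\<^sub>C x) = c *\<^sub>C p x"
      by (intro uniq) (simp_all add: p S cvs.subspace_scale cvs.scale_right_diff_distrib)
  qed (rule cvs.vector_space_axioms)+
  obtain B where B: "B \<subseteq> W1" "cvs.independent B" "W1 \<subseteq> cvs.span B" "card B = cvs.dim W1"
    using cvs.basis_exists by metis
  have spB: "cvs.span B = W1"
    using B S cvs.span_minimal by blast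
  have inj: "inj_on p W1"
  proof (rule inj_onI)
    fix x y assume xy: "x \<in> W1" "y \<in> W1" "p x = p y"
    have "(x - p x) - (y - p y) \<in> V" using p V cvs.subspace_diff by blast
    then have "x - y \<in> V \<inter> W1" using xy S cvs.subspace_diff by auto
    then have "x - y = 0" using W1 unfolding ccomplement_def by blast
    then show "x = y" by simp
  qed
  have ind: "cvs.independent (p ` B)"
    by (rule P.linear_independent_injective_image[OF lin B(2)]) (simp add: spB inj)
  obtain D where D: "D \<subseteq> W2" "cvs.independent D" "W2 \<subseteq> cvs.span D" "card D = cvs.dim W2"
    using cvs.basis_exists by metis
  have fD: "finite D"
    using cvs.independent_span_bound[OF C(1) D(2)] D C by blast
  have "finite (p ` B) \<and> card (p ` B) \<le> card D"
    by (rule cvs.independent_span_bound[OF fD ind]) (use p D in auto)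
  moreover have injB: "inj_on p B"
    using inj B inj_on_subset by blast
  ultimately have "finite B" "card B \<le> card D"
    by (auto simp: card_image finite_image_iff)
  then show ?thesis
    using B D True unfolding cdim_def by auto
qed

lemma ccodim_eq:
  assumes "cvs.subspace V" "ccomplement V W"
  shows "ccodim V = cdim W"
  unfolding ccodim_def
  by (rule the_equality) (use assms in \<open>blast intro: antisym cdim_ccomplement_le\<close>)+

definition bounded_operator :: "('a :: complex_banach \<Rightarrow> 'a) \<Rightarrow> bool" where
  "bounded_operator T \<longleftrightarrow> bounded_linear T \<and> (\<forall>c x. T (c *\<^sub>C x) = c *\<^sub>C T x)"

definition shift :: "('a :: complex_banach \<Rightarrow> 'a) \<Rightarrow> complex \<Rightarrow> 'a \<Rightarrow> 'a" where
  "shift T z = (\<lambda>x. T x - z *\<^sub>C x)"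

definition null_space :: "('a :: complex_banach \<Rightarrow> 'a) \<Rightarrow> 'a set" where
  "null_space S = {x. S x = 0}"

definition nullity :: "('a :: complex_banach \<Rightarrow> 'a) \<Rightarrow> enat" where
  "nullity S = cdim (null_space S)"

definition defect :: "('a :: complex_banach \<Rightarrow> 'a) \<Rightarrow> enat" where
  "defect S = ccodim (range S)"

definition invertible_op :: "('a :: complex_banach \<Rightarrow> 'a) \<Rightarrow> bool" where
  "invertible_op S \<longleftrightarrow> (\<exists>R. bounded_operator R \<and> R \<circ> S = id \<and> S \<circ> R = id)"

definition bounded_below :: "('a :: complex_banach \<Rightarrow> 'a) \<Rightarrow> bool" where
  "bounded_below S \<longleftrightarrow> inj S \<and> closed (range S)"

definition upper_semi_fredholm :: "('a :: complex_banach \<Rightarrow> 'a) \<Rightarrow> bool" where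
  "upper_semi_fredholm S \<longleftrightarrow> closed (range S) \<and> nullity S < \<infinity>"

definition lower_semi_fredholm :: "('a :: complex_banach \<Rightarrow> 'a) \<Rightarrow> bool" where
  "lower_semi_fredholm S \<longleftrightarrow> closed (range S) \<and> defect S < \<infinity>"

definition fredholm :: "('a :: complex_banach \<Rightarrow> 'a) \<Rightarrow> bool" where
  "fredholm S \<longleftrightarrow> closed (range S) \<and> nullity S < \<infinity> \<and> defect S < \<infinity>"

text \<open>
  The index may be \<open>\<plusminus>\<infinity>\<close>.  It is meaningful only for semi-Fredholm operators, where \<open>\<infinity> - \<infinity>\<close> does
  not occur.
\<close>

definition index :: "('a :: complex_banach \<Rightarrow> 'a) \<Rightarrow> ereal" where
  "index S = ereal_of_enat (nullity S) - ereal_of_enat (defect S)"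

definition upper_semi_weyl :: "('a :: complex_banach \<Rightarrow> 'a) \<Rightarrow> bool" where
  "upper_semi_weyl S \<longleftrightarrow> upper_semi_fredholm S \<and> index S \<le> 0"

definition lower_semi_weyl :: "('a :: complex_banach \<Rightarrow> 'a) \<Rightarrow> bool" where
  "lower_semi_weyl S \<longleftrightarrow> lower_semi_fredholm S \<and> index S \<ge> 0"

definition ascent :: "('a :: complex_banach \<Rightarrow> 'a) \<Rightarrow> enat" where
  "ascent S = (if \<exists>p. null_space (S ^^ p) = null_space (S ^^ (p + 1))
     then enat (LEAST p. null_space (S ^^ p) = null_space (S ^^ (p + 1))) else \<infinity>)"

definition descent :: "('a :: complex_banach \<Rightarrow> 'a) \<Rightarrow> enat" where
  "descent S = (if \<exists>q. range (S ^^ q) = range (S ^^ (q + 1))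
     then enat (LEAST q. range (S ^^ q) = range (S ^^ (q + 1))) else \<infinity>)"

definition browder :: "('a :: complex_banach \<Rightarrow> 'a) \<Rightarrow> bool" where
  "browder S \<longleftrightarrow> fredholm S \<and> ascent S < \<infinity> \<and> descent S < \<infinity>"

definition left_drazin_invertible :: "('a :: complex_banach \<Rightarrow> 'a) \<Rightarrow> bool" where
  "left_drazin_invertible S \<longleftrightarrow> (\<exists>p. ascent S = enat p \<and> closed (range (S ^^ (p + 1))))"

definition spectrum :: "('a :: complex_banach \<Rightarrow> 'a) \<Rightarrow> complex set"  (\<open>\<sigma>\<close>) where
  "\<sigma> T = {z. \<not> invertible_op (shift T z)}"

definition spectrum_ap :: "('a :: complex_banach \<Rightarrow> 'a) \<Rightarrow> complex set"  (\<open>\<sigma>\<^sub>a\<^sub>p\<close>) where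
  "\<sigma>\<^sub>a\<^sub>p T = {z. \<not> bounded_below (shift T z)}"

definition spectrum_su :: "('a :: complex_banach \<Rightarrow> 'a) \<Rightarrow> complex set"  (\<open>\<sigma>\<^sub>s\<^sub>u\<close>) where
  "\<sigma>\<^sub>s\<^sub>u T = {z. range (shift T z) \<noteq> UNIV}"

definition spectrum_uw :: "('a :: complex_banach \<Rightarrow> 'a) \<Rightarrow> complex set"  (\<open>\<sigma>\<^sub>u\<^sub>w\<close>) where
  "\<sigma>\<^sub>u\<^sub>w T = {z. \<not> upper_semi_weyl (shift T z)}"

definition spectrum_lw :: "('a :: complex_banach \<Rightarrow> 'a) \<Rightarrow> complex set"  (\<open>\<sigma>\<^sub>l\<^sub>w\<close>) where
  "\<sigma>\<^sub>l\<^sub>w T = {z. \<not> lower_semi_weyl (shift T z)}"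

definition spectrum_b :: "('a :: complex_banach \<Rightarrow> 'a) \<Rightarrow> complex set"  (\<open>\<sigma>\<^sub>b\<close>) where
  "\<sigma>\<^sub>b T = {z. \<not> browder (shift T z)}"

definition spectrum_desc :: "('a :: complex_banach \<Rightarrow> 'a) \<Rightarrow> complex set"  (\<open>\<sigma>\<^sub>d\<^sub>e\<^sub>s\<^sub>c\<close>) where
  "\<sigma>\<^sub>d\<^sub>e\<^sub>s\<^sub>c T = {z. descent (shift T z) = \<infinity>}"

definition spectrum_LD :: "('a :: complex_banach \<Rightarrow> 'a) \<Rightarrow> complex set"  (\<open>\<sigma>\<^sub>L\<^sub>D\<close>) where
  "\<sigma>\<^sub>L\<^sub>D T = {z. \<not> left_drazin_invertible (shift T z)}"

definition isolated_points :: "complex set \<Rightarrow> complex set" where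
  "isolated_points F = {z. z isolated_in F}"

end

theory Submission
  imports Defs
begin

text \<open>
  Write \<open>S = T - z\<close>.  Two perturbation facts hold on a punctured disc around \<open>0\<close>: if \<open>S\<close> has finite
  descent, then \<open>S - e\<close> is surjective (\<open>finite_descent_imp_shift_surj\<close>); if \<open>S\<close> is left Drazin
  invertible, then \<open>S - e\<close> is injective (\<open>finite_ascent_imp_shift_inj\<close>).  Hence a point outside the
  interior of \<open>\<sigma>\<^sub>d\<^sub>e\<^sub>s\<^sub>c T\<close> is a limit of points \<open>w\<close> with \<open>T - w\<close> surjective, and a point outside
  the interior of \<open>\<sigma>\<^sub>L\<^sub>D T\<close> is a limit of points \<open>w\<close> with \<open>T - w\<close> injective.

  The formulas for the Browder spectrum therefore amount to two statements: an upper semi-Weyl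
  operator \<open>S\<close> with surjective \<open>S - e\<close> for arbitrarily small \<open>e\<close> is Browder
  (\<open>upper_semi_weyl_browder\<close>), and so is a lower semi-Weyl operator with injective \<open>S - e\<close> for
  arbitrarily small \<open>e\<close> (\<open>lower_semi_weyl_browder\<close>).  The analytic half of their proof concerns the
  hyperrange \<open>U = \<Inter>n. R(S\<^sup>n)\<close>.  For a semi-Fredholm operator the ranges \<open>R(S\<^sup>n)\<close> are closed and
  \<open>N(S) \<inter> R(S\<^sup>m) \<subseteq> U\<close> for some \<open>m\<close>, so \<open>S\<close> maps \<open>U\<close> onto itself and is bounded below on
  \<open>R(S\<^sup>m)\<close> modulo \<open>U\<close>.  If the ascent is infinite, \<open>N(S) \<inter> U\<close> is not zero, and a power series in
  \<open>e\<close> continues its elements to kernel vectors of all \<open>S - e\<close> with \<open>e\<close> small; this is excluded in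
  the lower case.  In the upper case the lower bound carries the surjectivity of \<open>S - e\<close> on
  \<open>R(S\<^sup>m)\<close> over to \<open>S\<close>, and the descent is finite.  The algebraic half is the identity
  \<open>kernel_growth_balance\<close>, which turns finite descent into finite ascent, and conversely, according
  to the sign of the index, and shows that Browder operators have index zero.

  A bounded below or surjective Browder operator is thus invertible, which gives the formulas for
  \<open>\<sigma> T\<close>.  The statements about isolated points follow from these formulas, because a punctured disc
  in the plane is connected (\<open>isolated_points_subset\<close>).
\<close>

section \<open>The open mapping theorem on closed subspaces\<close>

lemma geometric_series_in_closed_subspace:
  fixes x :: "nat \<Rightarrow> 'a::banach"
  assumes M: "subspace M" "closed M" and xM: "\<And>n. x n \<in> M"
    and bound: "\<And>n. norm (x n) \<le> K * r ^ n" and r: "0 \<le> r" "r < 1"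
  shows "summable x" "(\<Sum>n. x n) \<in> M" "norm (\<Sum>n. x n) \<le> K / (1 - r)"
proof -
  have geo: "summable (\<lambda>n. K * r ^ n)" "(\<Sum>n. K * r ^ n) = K / (1 - r)"
    using r by (auto simp: suminf_mult suminf_geometric summable_geometric)
  have sn: "summable (\<lambda>n. norm (x n))"
    by (rule summable_comparison_test'[OF geo(1)]) (use bound in auto)
  then show sx: "summable x"
    by (rule summable_norm_cancel)
  have "(\<Sum>i<n. x i) \<in> M" for n
    using M(1) xM by (intro subspace_sum) auto
  with sx show "(\<Sum>n. x n) \<in> M"
    using closed_sequentially[OF M(2), of "\<lambda>n. \<Sum>i<n. x i"] summable_LIMSEQ by blast
  have "norm (\<Sum>n. x n) \<le> (\<Sum>n. norm (x n))"
    by (rule summable_norm[OF sn])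
  also have "\<dots> \<le> (\<Sum>n. K * r ^ n)"
    by (rule suminf_le[OF bound sn geo(1)])
  finally show "norm (\<Sum>n. x n) \<le> K / (1 - r)"
    using geo(2) by simp
qed

text \<open>
  Baire's theorem makes the closure of some \<open>f (M \<inter> cball 0 n)\<close> a neighbourhood of a point of
  \<open>f M\<close>, and translating that point to the origin costs only a factor \<open>2\<close>.
\<close>

lemma approximate_preimage_bound:
  fixes f :: "'a::banach \<Rightarrow> 'b::banach"
  assumes f: "bounded_linear f" and M: "subspace M" and Y: "closed (f ` M)"
  obtains K where "K > 0"
    "\<And>y d. y \<in> f ` M \<Longrightarrow> d > 0 \<Longrightarrow> \<exists>x\<in>M. norm x \<le> K * norm y \<and> norm (y - f x) < d"
proof -
  interpret f: bounded_linear f by fact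
  have sY: "subspace (f ` M)"
    using M f.linear_axioms by (intro linear_subspace_image) auto
  define E where "E n = closure (f ` (M \<inter> cball 0 (real n)))" for n :: nat
  have EY: "E n \<subseteq> f ` M" for n
    unfolding E_def using Y by (intro closure_minimal) auto
  have "f ` M \<subseteq> (\<Union>n. E n)"
  proof
    fix y assume "y \<in> f ` M"
    then obtain x where x: "x \<in> M" "y = f x" by blast
    obtain n where "norm x \<le> real n" using real_arch_simple by blast
    then have "y \<in> f ` (M \<inter> cball 0 (real n))" using x by auto
    then have "y \<in> E n" unfolding E_def by (rule subsetD[OF closure_subset])
    then show "y \<in> (\<Union>n. E n)" by blast
  qed
  with EY have UE: "\<Union>(range E) = f ` M" by blast
  have "\<exists>n. top_of_set (f ` M) interior_of E n \<noteq> {}"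
  proof (rule ccontr)
    assume "\<not> ?thesis"
    then have "\<And>T. T \<in> range E \<Longrightarrow> closedin (top_of_set (f ` M)) T \<and> top_of_set (f ` M) interior_of T = {}"
      using EY by (auto simp: E_def closed_subset)
    moreover have "completely_metrizable_space (top_of_set (f ` M))"
      using Y completely_metrizable_space_closedin completely_metrizable_space_euclidean
      by (metis closed_closedin)
    ultimately have "top_of_set (f ` M) interior_of \<Union>(range E) = {}"
      by (intro Baire_category_alt) auto
    then have "top_of_set (f ` M) interior_of (topspace (top_of_set (f ` M))) = {}"
      by (simp add: UE)
    then have "f ` M = {}"
      by (metis interior_of_topspace topspace_euclidean_subtopology)
    then show False using subspace_0[OF sY] by blast
  qed
  then obtain n y0 U where U: "openin (top_of_set (f ` M)) U" "y0 \<in> U" "U \<subseteq> E n"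
    unfolding interior_of_def by auto
  then obtain r where r: "r > 0" "\<And>y. y \<in> f ` M \<Longrightarrow> dist y y0 < r \<Longrightarrow> y \<in> E n"
    unfolding openin_euclidean_subtopology_iff by (metis subset_iff)
  have y0: "y0 \<in> f ` M" using U openin_imp_subset by blast
  have approx: "\<exists>x\<in>M. norm x \<le> real n \<and> dist (f x) z < e" if "z \<in> E n" "e > 0" for z e
    using that(1)[unfolded E_def closure_approachable, rule_format, OF that(2)] by auto
  \<comment> \<open>A factor \<open>2\<close> comes from the difference of two preimages in \<open>cball 0 n\<close>, another from
    rescaling \<open>y\<close> to norm \<open>r / 2\<close>; the summand \<open>1\<close> keeps \<open>K\<close> positive when \<open>n = 0\<close>.\<close>
  define K where "K = 4 * (real n + 1) / r"
  show thesis
  proof (rule that)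
    show "K > 0" unfolding K_def using r by simp
    fix y d assume y: "y \<in> f ` M" and d: "(0::real) < d"
    show "\<exists>x\<in>M. norm x \<le> K * norm y \<and> norm (y - f x) < d"
    proof (cases "y = 0")
      case True
      then show ?thesis using subspace_0[OF M] d by (intro bexI[of _ 0]) (auto simp: f.zero)
    next
      case False
      define s where "s = r / (2 * norm y)"
      have s: "s > 0" unfolding s_def using r False by simp
      have "y0 + s *\<^sub>R y \<in> E n"
      proof (rule r(2))
        show "y0 + s *\<^sub>R y \<in> f ` M"
          using sY y0 y by (simp add: subspace_add subspace_scale)
        show "dist (y0 + s *\<^sub>R y) y0 < r"
          using r False by (simp add: dist_norm s_def)
      qed
      then obtain x1 where x1: "x1 \<in> M" "norm x1 \<le> real n" "dist (f x1) (y0 + s *\<^sub>R y) < s * d / 2"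
        using approx[of "y0 + s *\<^sub>R y" "s * d / 2"] s d by auto
      have "y0 \<in> E n" using r y0 by simp
      then obtain x2 where x2: "x2 \<in> M" "norm x2 \<le> real n" "dist (f x2) y0 < s * d / 2"
        using approx[of y0 "s * d / 2"] s d by auto
      define x where "x = (x1 - x2) /\<^sub>R s"
      have "norm x \<le> (real n + real n) / s"
        unfolding x_def using s norm_triangle_ineq4[of x1 x2] x1(2) x2(2)
        by (simp add: divide_simps)
      also have "\<dots> \<le> K * norm y"
        unfolding K_def s_def using r False by (simp add: divide_simps)
      finally have "norm x \<le> K * norm y" .
      moreover have "norm (y - f x) < d"
      proof -
        have "s *\<^sub>R (y - f x) = (f x2 - y0) - (f x1 - (y0 + s *\<^sub>R y))"
          unfolding x_def using s by (simp add: f.scaleR f.diff algebra_simps)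
        then have "s * norm (y - f x) = norm ((f x2 - y0) - (f x1 - (y0 + s *\<^sub>R y)))"
          using s by (metis abs_of_pos norm_scaleR)
        also have "\<dots> \<le> norm (f x2 - y0) + norm (f x1 - (y0 + s *\<^sub>R y))"
          by (rule norm_triangle_ineq4)
        also have "\<dots> < s * d"
          using x1(3) x2(3) unfolding dist_norm by simp
        finally show ?thesis using s by simp
      qed
      moreover have "x \<in> M" unfolding x_def using M x1 x2 by (simp add: subspace_diff subspace_scale)
      ultimately show ?thesis by blast
    qed
  qed
qed

text \<open>
  Correcting an approximate preimage by one of the remaining error halves the error at each step;
  the corrections form a geometric series in \<open>M\<close>.
\<close>

theorem open_mapping_closed_subspace:
  fixes f :: "'a::banach \<Rightarrow> 'b::banach"
  assumes f: "bounded_linear f" and M: "subspace M" "closed M" and Y: "closed (f ` M)"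
  shows "\<exists>C>0. \<forall>y\<in>f ` M. \<exists>x\<in>M. f x = y \<and> norm x \<le> C * norm y"
proof -
  interpret f: bounded_linear f by fact
  have sY: "subspace (f ` M)"
    using M f.linear_axioms by (intro linear_subspace_image) auto
  obtain K where K: "K > 0"
    "\<And>y d. y \<in> f ` M \<Longrightarrow> d > 0 \<Longrightarrow> \<exists>x\<in>M. norm x \<le> K * norm y \<and> norm (y - f x) < d"
    using approximate_preimage_bound[OF f M(1) Y] by blast
  show ?thesis
  proof (intro exI[of _ "2 * K"] conjI ballI)
    show "2 * K > 0" using K by simp
    fix y assume y: "y \<in> f ` M"
    show "\<exists>x\<in>M. f x = y \<and> norm x \<le> 2 * K * norm y"
    proof (cases "y = 0")
      case True
      then show ?thesis using subspace_0[OF M(1)] by (intro bexI[of _ 0]) (auto simp: f.zero)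
    next
      case False
      have "\<exists>x\<in>M. norm x \<le> K * norm w \<and> norm (w - f x) \<le> norm w / 2" if "w \<in> f ` M" for w
      proof (cases "w = 0")
        case True
        then show ?thesis using subspace_0[OF M(1)] by (intro bexI[of _ 0]) (auto simp: f.zero)
      next
        case False
        then show ?thesis using K(2)[OF that, of "norm w / 2"] by fastforce
      qed
      then obtain g where g: "\<And>w. w \<in> f ` M \<Longrightarrow> g w \<in> M"
        "\<And>w. w \<in> f ` M \<Longrightarrow> norm (g w) \<le> K * norm w"
        "\<And>w. w \<in> f ` M \<Longrightarrow> norm (w - f (g w)) \<le> norm w / 2"
        by metis
      define w where "w = rec_nat y (\<lambda>_ w. w - f (g w))"
      have w0: "w 0 = y" and wS: "\<And>n. w (Suc n) = w n - f (g (w n))"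
        by (simp_all add: w_def)
      have wY: "w n \<in> f ` M" for n
        by (induction n) (use y g sY in \<open>auto simp: w0 wS intro!: subspace_diff\<close>)
      have wn: "norm (w n) \<le> norm y * (1/2) ^ n" for n
      proof (induction n)
        case (Suc n)
        then show ?case using g(3)[OF wY[of n]] by (simp add: wS)
      qed (simp add: w0)
      have gn: "norm (g (w n)) \<le> K * norm y * (1/2) ^ n" for n
        using g(2)[OF wY[of n]] mult_left_mono[OF wn[of n], of K] K(1)
        by (simp add: mult.assoc order_trans)
      note geo = geometric_series_in_closed_subspace[OF M, of "\<lambda>n. g (w n)", OF g(1)[OF wY] gn]
      have "(\<lambda>n. f (g (w n))) sums f (\<Sum>n. g (w n))"
        using geo(1) by (intro f.sums summable_sums) auto
      moreover have "(\<lambda>n. f (g (w n))) sums y"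
      proof -
        have "w \<longlonglongrightarrow> 0"
        proof (rule Lim_null_comparison[OF always_eventually])
          show "\<forall>n. norm (w n) \<le> norm y * (1/2) ^ n" using wn by simp
          show "(\<lambda>n. norm y * (1/2) ^ n) \<longlonglongrightarrow> 0"
            by (intro tendsto_mult_right_zero LIMSEQ_power_zero) simp
        qed
        then have "(\<lambda>n. w n - w (Suc n)) sums (w 0 - 0)"
          by (rule telescope_sums')
        then show ?thesis by (simp add: wS w0)
      qed
      ultimately have "f (\<Sum>n. g (w n)) = y"
        by (rule sums_unique2)
      then show ?thesis
        using geo(2,3) by (intro bexI[of _ "\<Sum>n. g (w n)"]) auto
    qed
  qed
qed

section \<open>Bounded operators and complex subspaces\<close>

global_interpretation cvp: vector_space_pair
  "scaleC :: complex \<Rightarrow> 'a \<Rightarrow> 'a :: complex_banach" "scaleC :: complex \<Rightarrow> 'b \<Rightarrow> 'b :: complex_banach"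
  by unfold_locales

lemma csubspace_imp_subspace: "cvs.subspace V \<Longrightarrow> subspace V"
  unfolding subspace_def cvs.subspace_def by (metis scaleC_complex_of_real)

lemma bounded_linear_scaleC: "bounded_linear (\<lambda>x :: 'a :: complex_banach. c *\<^sub>C x)"
proof (rule bounded_linear_intro[where K = "cmod c"])
  fix r :: real and x :: 'a
  show "c *\<^sub>C r *\<^sub>R x = r *\<^sub>R c *\<^sub>C x"
    by (simp add: scaleC_complex_of_real[symmetric] scaleC_scaleC mult.commute)
qed (simp_all add: scaleC_add_right norm_scaleC mult.commute)

locale bounded_op =
  fixes S :: "'a :: complex_banach \<Rightarrow> 'a"
  assumes bounded_operator: "bounded_operator S"
begin

lemma bounded_linear: "bounded_linear S"
  using bounded_operator by (simp add: bounded_operator_def)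

sublocale bounded_linear S
  by (rule bounded_linear)

lemma scaleC: "S (c *\<^sub>C x) = c *\<^sub>C S x"
  using bounded_operator by (simp add: bounded_operator_def)

lemma clinear: "Vector_Spaces.linear scaleC scaleC S"
  by (simp add: Vector_Spaces.linear_iff cvs.vector_space_axioms add scaleC)

lemma csubspace_image: "cvs.subspace V \<Longrightarrow> cvs.subspace (S ` V)"
  by (rule cvp.linear_subspace_image[OF clinear])

lemma csubspace_range: "cvs.subspace (range S)"
  by (rule csubspace_image) simp

lemma csubspace_null_space: "cvs.subspace (null_space S)"
  unfolding null_space_def by (rule cvp.linear_subspace_kernel[OF clinear])

lemma bounded_op_funpow: "bounded_op (S ^^ n)"
proof (induction n)
  case 0
  then show ?case by unfold_locales (simp add: bounded_operator_def id_def bounded_linear_ident)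
next
  case (Suc n)
  then interpret Sn: bounded_op "S ^^ n" .
  show ?case
    by unfold_locales (use bounded_linear_compose[OF bounded_linear Sn.bounded_linear] in
      \<open>simp add: bounded_operator_def o_def Sn.scaleC scaleC\<close>)
qed

lemma bounded_op_shift: "bounded_op (shift S e)"
  by unfold_locales
    (simp add: bounded_operator_def shift_def scaleC cvs.scale_right_diff_distrib scaleC_scaleC mult.commute
      bounded_linear_sub[OF bounded_linear bounded_linear_scaleC])

lemma funpow_shift: "(S ^^ n) (shift S e x) = shift S e ((S ^^ n) x)"
proof -
  interpret Sn: bounded_op "S ^^ n" by (rule bounded_op_funpow)
  show ?thesis by (simp add: shift_def Sn.diff Sn.scaleC funpow_swap1)
qed

lemma funpow_zero [simp]: "(S ^^ n) 0 = 0"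
  by (induction n) (auto simp: zero)

lemma range_funpow_antimono: "m \<le> n \<Longrightarrow> range (S ^^ n) \<subseteq> range (S ^^ m)"
proof -
  assume "m \<le> n"
  then have "S ^^ n = S ^^ m \<circ> S ^^ (n - m)"
    by (simp add: funpow_add[symmetric])
  then show ?thesis by auto
qed

lemma null_space_funpow_mono: "m \<le> n \<Longrightarrow> null_space (S ^^ m) \<subseteq> null_space (S ^^ n)"
proof -
  assume "m \<le> n"
  then have "S ^^ n = S ^^ (n - m) \<circ> S ^^ m"
    by (simp add: funpow_add[symmetric])
  then show ?thesis by (auto simp: null_space_def)
qed

lemma range_funpow_Suc: "range (S ^^ Suc n) = S ` range (S ^^ n)"
  by (simp add: image_comp)

lemma range_funpow_stable:
  assumes "range (S ^^ Suc q) = range (S ^^ q)" "q \<le> n"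
  shows "range (S ^^ Suc n) = range (S ^^ n)"
  using assms(2)
proof (induction n rule: dec_induct)
  case (step n)
  then show ?case by (metis range_funpow_Suc)
qed (rule assms(1))

lemma null_space_funpow_stable:
  assumes "null_space (S ^^ Suc p) = null_space (S ^^ p)" "p \<le> n"
  shows "null_space (S ^^ Suc n) = null_space (S ^^ n)"
  using assms(2)
proof (induction n rule: dec_induct)
  case (step n)
  have "null_space (S ^^ Suc k) = S -` null_space (S ^^ k)" for k
    by (auto simp: null_space_def funpow_Suc_right simp del: funpow.simps)
  then show ?case by (metis step.IH)
qed (rule assms(1))

end

lemma descent_finite_iff: "descent S < \<infinity> \<longleftrightarrow> (\<exists>q. range (S ^^ Suc q) = range (S ^^ q))"
  unfolding descent_def by (auto simp del: funpow.simps simp: eq_commute)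

lemma ascent_finite_iff: "ascent S < \<infinity> \<longleftrightarrow> (\<exists>p. null_space (S ^^ Suc p) = null_space (S ^^ p))"
  unfolding ascent_def by (auto simp del: funpow.simps simp: eq_commute)

lemma shift_shift: "shift (shift T z) e = shift T (z + e)"
  by (rule ext) (simp add: shift_def scaleC_add_left algebra_simps)

section \<open>Finite-dimensional extensions of closed subspaces\<close>

text \<open>
  For \<open>v \<notin> M\<close> the coefficient of \<open>v\<close> is a bounded function of \<open>m + c v\<close>, since
  \<open>dist(v, M)\<close> is positive.
\<close>

lemma closed_span_insert:
  fixes M :: "'a::complex_banach set"
  assumes M: "cvs.subspace M" "closed M"
  shows "closed (cvs.span (insert v M))"
proof (cases "v \<in> M")
  case True
  then show ?thesis using M by (metis insert_absorb cvs.span_eq_iff)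
next
  case False
  have ne: "M \<noteq> {}" using M(1) cvs.subspace_0 by blast
  define d where "d = infdist v M"
  have d: "d > 0"
    unfolding d_def using infdist_pos_not_in_closed[OF M(2) ne False] .
  have coeff: "cmod c * d \<le> norm (m + c *\<^sub>C v)" if m: "m \<in> M" for c m
  proof (cases "c = 0")
    case False
    have "- (inverse c *\<^sub>C m) \<in> M" using M(1) m by (simp add: cvs.subspace_scale cvs.subspace_neg)
    then have "d \<le> dist v (- (inverse c *\<^sub>C m))"
      unfolding d_def by (rule infdist_le)
    also have "\<dots> = norm (v + inverse c *\<^sub>C m)" by (simp add: dist_norm)
    finally have "cmod c * d \<le> cmod c * norm (v + inverse c *\<^sub>C m)"
      by (intro mult_left_mono) auto
    also have "\<dots> = norm (m + c *\<^sub>C v)"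
      using False by (simp add: norm_scaleC[symmetric] scaleC_add_right scaleC_scaleC add.commute)
    finally show ?thesis .
  qed simp
  have span: "cvs.span (insert v M) = {x. \<exists>k. x - k *\<^sub>C v \<in> M}"
    using M(1) by (simp add: cvs.span_insert cvs.span_eq_iff[THEN iffD2])
  show ?thesis
    unfolding closed_sequential_limits
  proof (intro allI impI, elim conjE)
    fix y l assume y: "\<forall>n. y n \<in> cvs.span (insert v M)" and l: "y \<longlonglongrightarrow> l"
    then obtain c where c: "\<And>n. y n - c n *\<^sub>C v \<in> M"
      unfolding span by simp metis
    have cn: "cmod (c m - c n) * d \<le> norm (y m - y n)" for m n
    proof -
      have "(y m - c m *\<^sub>C v) - (y n - c n *\<^sub>C v) \<in> M"
        using c M(1) cvs.subspace_diff by blast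
      from coeff[OF this, of "c m - c n"] show ?thesis
        by (simp add: cvs.scale_left_diff_distrib)
    qed
    have "Cauchy c"
    proof (rule metric_CauchyI)
      fix e :: real assume e: "e > 0"
      have "Cauchy y" using l by (rule LIMSEQ_imp_Cauchy)
      then obtain N where N: "\<And>m n. m \<ge> N \<Longrightarrow> n \<ge> N \<Longrightarrow> dist (y m) (y n) < e * d"
        using e d metric_CauchyD by (metis mult_pos_pos)
      have "dist (c m) (c n) < e" if "m \<ge> N" "n \<ge> N" for m n
        using cn[of m n] N[OF that] d unfolding dist_norm
        by (meson le_less_trans mult_less_cancel_right_pos)
      then show "\<exists>N. \<forall>m\<ge>N. \<forall>n\<ge>N. dist (c m) (c n) < e" by blast
    qed
    then obtain k where k: "c \<longlonglongrightarrow> k"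
      using Cauchy_convergent_iff convergent_def by blast
    have "(\<lambda>n. (c n - k) *\<^sub>C v) \<longlonglongrightarrow> 0"
    proof (rule tendsto_norm_zero_cancel)
      have "(\<lambda>n. cmod (c n - k) * norm v) \<longlonglongrightarrow> 0"
        using k by (intro tendsto_mult_left_zero tendsto_norm_zero) (simp add: LIM_zero_iff)
      then show "(\<lambda>n. norm ((c n - k) *\<^sub>C v)) \<longlonglongrightarrow> 0" by (simp add: norm_scaleC)
    qed
    from tendsto_diff[OF l tendsto_add[OF this tendsto_const[of "k *\<^sub>C v"]]]
    have "(\<lambda>n. y n - c n *\<^sub>C v) \<longlonglongrightarrow> l - k *\<^sub>C v"
      by (simp add: cvs.scale_left_diff_distrib)
    then have "l - k *\<^sub>C v \<in> M"
      by (rule closed_sequentially[OF M(2) c])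
    then show "l \<in> cvs.span (insert v M)" unfolding span by blast
  qed
qed

lemma closed_span_Un_finite:
  assumes M: "cvs.subspace M" "closed M" and B: "finite B"
  shows "closed (cvs.span (B \<union> M))"
  using B
proof induction
  case empty
  then show ?case using M by (simp add: cvs.span_eq_iff[THEN iffD2])
next
  case (insert b B)
  have "closed (cvs.span (insert b (cvs.span (B \<union> M))))"
    by (rule closed_span_insert[OF cvs.subspace_span insert.IH])
  also have "cvs.span (insert b (cvs.span (B \<union> M))) = cvs.span (insert b B \<union> M)"
    by (simp add: cvs.span_insert cvs.span_span)
  finally show ?case .
qed

lemma closed_csubspace_finite_dim:
  assumes "cvs.subspace V" "finite B" "V \<subseteq> cvs.span B"
  shows "closed V"
proof -
  obtain D where D: "D \<subseteq> V" "cvs.independent D" "V \<subseteq> cvs.span D"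
    using cvs.maximal_independent_subset by metis
  have "finite D" using cvs.independent_span_bound[OF assms(2) D(2)] D(1) assms(3) by blast
  then have "closed (cvs.span (D \<union> {0}))"
    by (intro closed_span_Un_finite) auto
  moreover have "cvs.span (D \<union> {0}) = V"
    using D assms(1) cvs.span_minimal by (metis cvs.span_insert_0 Un_insert_right sup_bot.right_neutral subset_antisym)
  ultimately show ?thesis by simp
qed

section \<open>Small perturbations by multiples of the identity\<close>

text \<open>
  The formal solution \<open>z = x\<^sub>0 + e x\<^sub>1 + e\<^sup>2 x\<^sub>2 + \<dots>\<close> of \<open>A z - e B z = A x\<^sub>0\<close> telescopes.  It is
  the source of solutions, as well as of kernel vectors (when \<open>A x\<^sub>0 = 0\<close>), of perturbed operators.
\<close>

lemma perturbation_series: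
  fixes A B :: "'a :: complex_banach \<Rightarrow> 'a"
  assumes A: "bounded_op A" and B: "bounded_op B" and M: "cvs.subspace M" "closed M"
    and xM: "\<And>n. x n \<in> M" and step: "\<And>n. A (x (Suc n)) = B (x n)"
    and growth: "\<And>n. norm (x (Suc n)) \<le> C * norm (x n)" and C: "C \<ge> 0" "C * cmod e < 1"
  obtains z where "z \<in> M" "A z - e *\<^sub>C B z = A (x 0)"
    "norm (z - x 0) \<le> C * cmod e * norm (x 0) / (1 - C * cmod e)"
proof -
  interpret A: bounded_op A by fact
  interpret B: bounded_op B by fact
  define y where "y n = e ^ n *\<^sub>C x n" for n
  have yM: "y n \<in> M" for n
    unfolding y_def using M xM by (simp add: cvs.subspace_scale)
  have xn: "norm (x n) \<le> norm (x 0) * C ^ n" for n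
  proof (induction n)
    case (Suc n)
    have "norm (x (Suc n)) \<le> C * (norm (x 0) * C ^ n)"
      using growth[of n] mult_left_mono[OF Suc.IH C(1)] by linarith
    then show ?case by (simp add: algebra_simps)
  qed simp
  have yn: "norm (y n) \<le> norm (x 0) * (C * cmod e) ^ n" for n
    using mult_left_mono[OF xn[of n], of "cmod e ^ n"]
    by (simp add: y_def norm_scaleC norm_power power_mult_distrib algebra_simps)
  have yS: "norm (y (Suc n)) \<le> (C * cmod e * norm (x 0)) * (C * cmod e) ^ n" for n
    using yn[of "Suc n"] by (simp add: algebra_simps)
  have r: "0 \<le> C * cmod e" using C by simp
  note geo = geometric_series_in_closed_subspace[OF csubspace_imp_subspace[OF M(1)] M(2)]
  note y = geo[of y, OF yM yn r C(2)] and yS = geo[of "\<lambda>n. y (Suc n)", OF yM yS r C(2)]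
  have Ay: "(\<lambda>n. A (y n)) sums A (\<Sum>n. y n)"
    using y(1) by (intro A.sums summable_sums)
  have "(\<lambda>n. e *\<^sub>C B (y n)) sums (e *\<^sub>C B (\<Sum>n. y n))"
    using y(1) by (intro bounded_linear.sums[OF bounded_linear_scaleC] B.sums summable_sums)
  from sums_diff[OF Ay this]
  have "(\<lambda>n. A (y n) - e *\<^sub>C B (y n)) sums (A (\<Sum>n. y n) - e *\<^sub>C B (\<Sum>n. y n))" .
  moreover have "e *\<^sub>C B (y n) = A (y (Suc n))" for n
    by (simp add: y_def A.scaleC B.scaleC step scaleC_scaleC)
  then have "(\<lambda>n. A (y n) - e *\<^sub>C B (y n)) sums (A (y 0) - 0)"
    using telescope_sums'[OF summable_LIMSEQ_zero[OF sums_summable[OF Ay]]] by simp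
  ultimately have "A (\<Sum>n. y n) - e *\<^sub>C B (\<Sum>n. y n) = A (y 0) - 0"
    by (rule sums_unique2)
  moreover have "(\<Sum>n. y n) - y 0 = (\<Sum>n. y (Suc n))"
    using suminf_split_head[OF y(1)] by simp
  moreover have "y 0 = x 0" by (simp add: y_def)
  ultimately show thesis
    using that[of "\<Sum>n. y n"] y(2) yS(3) by simp
qed

lemma eventually_at_0_small:
  fixes C :: real
  assumes "C > 0"
  shows "\<forall>\<^sub>F e :: complex in at 0. C * cmod e < 1"
  unfolding eventually_at
  by (rule exI[of _ "1 / C"]) (use assms in \<open>simp add: field_simps\<close>)

context bounded_op
begin

text \<open>
  If \<open>R(S\<^sup>d) = R(S\<^sup>d\<^sup>+\<^sup>1)\<close>, then \<open>R(S\<^sup>d)\<close>, with the norm of \<open>X / N(S\<^sup>d)\<close>, is a Banach space that \<open>S\<close> maps onto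
  itself.  Small perturbations keep this property, and \<open>R(S\<^sup>d) \<subseteq> R(S - e)\<close> with \<open>e \<noteq> 0\<close> forces
  \<open>R(S - e) = X\<close> as the polynomials \<open>z\<^sup>d\<close> and \<open>z - e\<close> are coprime.
\<close>

lemma finite_descent_imp_shift_surj:
  assumes d: "range (S ^^ Suc d) = range (S ^^ d)"
  shows "\<forall>\<^sub>F e in at 0. range (shift S e) = UNIV"
proof -
  interpret Sd: bounded_op "S ^^ d" by (rule bounded_op_funpow)
  interpret Sd1: bounded_op "S ^^ Suc d" by (rule bounded_op_funpow)
  \<comment> \<open>The open mapping theorem for the projection of this closed relation to its first component
    bounds the solutions \<open>x'\<close> of \<open>S\<^sup>d\<^sup>+\<^sup>1 x' = S\<^sup>d x\<close>; \<open>R(S\<^sup>d)\<close> itself need not be closed.\<close>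
  define G where "G = {p. (S ^^ d) (fst p) = (S ^^ Suc d) (snd p)}"
  have G: "subspace G"
    unfolding G_def subspace_def
    by (auto simp: Sd.add Sd1.add Sd.scaleR Sd1.scaleR Sd.zero Sd1.zero simp del: funpow.simps)
  have Gc: "closed G"
    unfolding G_def
    by (intro closed_Collect_eq Sd.continuous_on Sd1.continuous_on continuous_intros)
  have GU: "fst ` G = UNIV"
  proof -
    have "\<exists>x'. (S ^^ d) x = (S ^^ Suc d) x'" for x
      using d by (metis rangeE rangeI)
    then show ?thesis unfolding G_def by (auto simp: image_iff)
  qed
  have "closed (fst ` G)" by (simp add: GU)
  from open_mapping_closed_subspace[OF bounded_linear_fst G Gc this]
  obtain C where C: "C > 0" "\<forall>x. \<exists>p\<in>G. fst p = x \<and> norm p \<le> C * norm x"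
    unfolding GU by auto
  have "\<exists>x'. (S ^^ Suc d) x' = (S ^^ d) x \<and> norm x' \<le> C * norm x" for x
  proof -
    from C(2) obtain p where p: "p \<in> G" "fst p = x" "norm p \<le> C * norm x" by blast
    then show ?thesis
      using norm_snd_le[of "snd p" "fst p"] unfolding G_def by (intro exI[of _ "snd p"]) auto
  qed
  then obtain h where h: "\<And>x. (S ^^ Suc d) (h x) = (S ^^ d) x" "\<And>x. norm (h x) \<le> C * norm x"
    by metis
  have "range (shift S e) = UNIV" if e: "e \<noteq> 0" "C * cmod e < 1" for e
  proof -
    interpret Se: bounded_op "shift S e" by (rule bounded_op_shift)
    have "(S ^^ Suc d) x \<in> range (shift S e)" for x
    proof -
      \<comment> \<open>the series with \<open>A = S\<^sup>d\<^sup>+\<^sup>1\<close> and \<open>B = S\<^sup>d\<close>\<close>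
      obtain z where "(S ^^ Suc d) z - e *\<^sub>C (S ^^ d) z = (S ^^ Suc d) x"
        by (rule perturbation_series[OF Sd1.bounded_op_axioms Sd.bounded_op_axioms, of UNIV "\<lambda>n. (h ^^ n) x" C e])
          (use h C(1) e in auto)
      then have "(S ^^ Suc d) x = shift S e ((S ^^ d) z)" by (simp add: shift_def)
      then show ?thesis by simp
    qed
    then have Rd: "(S ^^ d) x \<in> range (shift S e)" for x
      using d by (metis rangeE rangeI)
    have "(S ^^ (d - k)) x \<in> range (shift S e)" for k x
    proof (induction k arbitrary: x)
      case 0
      show ?case using Rd by simp
    next
      case (Suc k)
      show ?case
      proof (cases "k < d")
        case True
        have "e *\<^sub>C (S ^^ (d - Suc k)) x = (S ^^ Suc (d - Suc k)) x - shift S e ((S ^^ (d - Suc k)) x)"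
          by (simp add: shift_def)
        also have "\<dots> \<in> range (shift S e)"
          using Suc.IH[of x] True Se.csubspace_range
          by (intro cvs.subspace_diff) (simp_all add: Suc_diff_Suc del: funpow.simps)
        finally have "inverse e *\<^sub>C e *\<^sub>C (S ^^ (d - Suc k)) x \<in> range (shift S e)"
          by (rule cvs.subspace_scale[OF Se.csubspace_range])
        then show ?thesis using e by (simp add: scaleC_scaleC)
      next
        case False
        then have "d - Suc k = d - k" by simp
        then show ?thesis using Suc.IH by metis
      qed
    qed
    from this[of d] show ?thesis by auto
  qed
  then show ?thesis
    using eventually_at_0_small[OF C(1)] unfolding eventually_at_filter by (auto elim: eventually_mono)
qed

text \<open>
  An eigenvector \<open>x\<close> for \<open>e\<close> satisfies \<open>S\<^sup>n x = e\<^sup>n x\<close>.  Solving \<open>S\<^sup>p\<^sup>+\<^sup>1 u = S\<^sup>p\<^sup>+\<^sup>1 x\<close> with a small \<open>u\<close> and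
  cancelling one \<open>S\<close>, as \<open>N(S\<^sup>p\<^sup>+\<^sup>1) = N(S\<^sup>p)\<close> permits, bounds \<open>norm (e\<^sup>p x)\<close> by a multiple of
  \<open>norm (e\<^sup>p\<^sup>+\<^sup>1 x)\<close>.
\<close>

lemma finite_ascent_imp_shift_inj:
  assumes p: "null_space (S ^^ Suc p) = null_space (S ^^ p)" and cl: "closed (range (S ^^ Suc p))"
  shows "\<forall>\<^sub>F e in at 0. inj (shift S e)"
proof -
  interpret Sp: bounded_op "S ^^ p" by (rule bounded_op_funpow)
  interpret Sp1: bounded_op "S ^^ Suc p" by (rule bounded_op_funpow)
  obtain C where C: "C > 0" "\<And>y. y \<in> range (S ^^ Suc p) \<Longrightarrow> \<exists>u. (S ^^ Suc p) u = y \<and> norm u \<le> C * norm y"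
    using open_mapping_closed_subspace[OF Sp1.bounded_linear, of UNIV] cl by auto
  obtain K where K: "K > 0" "\<And>x. norm ((S ^^ p) x) \<le> norm x * K"
    using Sp.pos_bounded by blast
  have "inj (shift S e)" if e: "e \<noteq> 0" "K * C * cmod e < 1" for e
  proof -
    interpret Se: bounded_op "shift S e" by (rule bounded_op_shift)
    have "x = 0" if "shift S e x = 0" for x
    proof -
      have Sx: "S x = e *\<^sub>C x" using that by (simp add: shift_def)
      have Sn: "(S ^^ n) x = e ^ n *\<^sub>C x" for n
        by (induction n) (simp_all add: Sx scaleC scaleC_scaleC mult.commute)
      obtain u where u: "(S ^^ Suc p) u = (S ^^ Suc p) x" "norm u \<le> C * norm ((S ^^ Suc p) x)"
        using C(2)[of "(S ^^ Suc p) x"] by auto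
      have "u - x \<in> null_space (S ^^ Suc p)"
        using u(1) unfolding null_space_def by (simp add: Sp1.diff del: funpow.simps)
      then have "(S ^^ p) u = (S ^^ p) x"
        unfolding p by (simp add: null_space_def Sp.diff)
      then have "norm ((S ^^ p) x) \<le> norm u * K" using K(2)[of u] by simp
      also have "\<dots> \<le> (C * norm ((S ^^ Suc p) x)) * K"
        using u(2) K(1) by (intro mult_right_mono) auto
      finally have "cmod e ^ p * norm x \<le> (K * C * cmod e) * (cmod e ^ p * norm x)"
        by (simp add: Sn norm_scaleC norm_power norm_mult algebra_simps del: funpow.simps)
      moreover have "(K * C * cmod e) * t < t" if "t > 0" for t
        using e(2) that mult_strict_right_mono by fastforce
      ultimately have "\<not> cmod e ^ p * norm x > 0" by fastforce
      then show ?thesis using e(1) by (simp add: zero_less_mult_iff)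
    qed
    then show ?thesis by (simp add: Se.inj_iff_eq_0)
  qed
  then show ?thesis
    using eventually_at_0_small[of "K * C"] C(1) K(1) unfolding eventually_at_filter
    by (auto elim: eventually_mono)
qed

end

section \<open>The distance to a subspace\<close>

lemma infdist_csubspace_greatest:
  assumes "cvs.subspace U" "\<And>v. v \<in> U \<Longrightarrow> c \<le> dist x v"
  shows "c \<le> infdist x U"
proof -
  have "U \<noteq> {}" using cvs.subspace_0[OF assms(1)] by blast
  then show ?thesis using assms(2) unfolding infdist_notempty[OF \<open>U \<noteq> {}\<close>] by (intro cINF_greatest)
qed

lemma infdist_csubspace_add_le:
  assumes U: "cvs.subspace U"
  shows "infdist (x + y) U \<le> infdist x U + infdist y U"
proof -
  have "infdist (x + y) U - dist x v \<le> infdist y U" if v: "v \<in> U" for v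
  proof (rule infdist_csubspace_greatest[OF U])
    fix w assume w: "w \<in> U"
    have "infdist (x + y) U \<le> dist (x + y) (v + w)"
      by (rule infdist_le) (rule cvs.subspace_add[OF U v w])
    also have "\<dots> \<le> dist x v + dist y w"
      by (rule dist_triangle_add)
    finally show "infdist (x + y) U - dist x v \<le> dist y w" by simp
  qed
  then have "infdist (x + y) U - infdist y U \<le> infdist x U"
    by (intro infdist_csubspace_greatest[OF U]) (simp add: algebra_simps)
  then show ?thesis by simp
qed

lemma infdist_csubspace_scaleC_le:
  assumes U: "cvs.subspace U"
  shows "infdist (c *\<^sub>C x) U \<le> cmod c * infdist x U"
proof (cases "c = 0")
  case True
  then show ?thesis using cvs.subspace_0[OF U] by simp
next
  case False
  have "infdist (c *\<^sub>C x) U / cmod c \<le> dist x v" if "v \<in> U" for v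
  proof -
    have "infdist (c *\<^sub>C x) U \<le> dist (c *\<^sub>C x) (c *\<^sub>C v)"
      using that by (intro infdist_le cvs.subspace_scale[OF U])
    also have "\<dots> = cmod c * dist x v"
      by (simp add: dist_norm norm_scaleC flip: cvs.scale_right_diff_distrib)
    finally show ?thesis using False by (simp add: field_simps)
  qed
  then have "infdist (c *\<^sub>C x) U / cmod c \<le> infdist x U"
    by (rule infdist_csubspace_greatest[OF U])
  then show ?thesis using False by (simp add: field_simps)
qed

text \<open>
  This is the idea of Riesz's lemma: translating \<open>y\<close> by elements of \<open>V\<close> does not change its
  distance to \<open>V\<close>, so the bound by half of the norm makes the distance at most half of itself.
\<close>

lemma subset_closed_csubspace_if_infdist_half:
  assumes V: "cvs.subspace V" "closed V" and Y: "cvs.subspace Y" "V \<subseteq> Y"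
    and half: "\<And>y. y \<in> Y \<Longrightarrow> infdist y V \<le> norm y / 2"
  shows "Y \<subseteq> V"
proof
  fix y assume y: "y \<in> Y"
  have "2 * infdist y V \<le> dist y s" if s: "s \<in> V" for s
  proof -
    have "infdist y V \<le> infdist (y - s) V"
      using infdist_csubspace_add_le[OF V(1), of "y - s" s] s by simp
    also have "\<dots> \<le> norm (y - s) / 2"
      using y s Y(2) by (intro half cvs.subspace_diff[OF Y(1)]) auto
    finally show ?thesis by (simp add: dist_norm)
  qed
  then have "2 * infdist y V \<le> infdist y V"
    by (rule infdist_csubspace_greatest[OF V(1)])
  then have "infdist y V = 0" using infdist_nonneg[of y V] by simp
  moreover have "V \<noteq> {}" using cvs.subspace_0[OF V(1)] by blast
  ultimately show "y \<in> V" using in_closed_iff_infdist_zero[OF V(2)] by blast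
qed

section \<open>The hyperrange\<close>

definition hyperrange :: "('a :: complex_banach \<Rightarrow> 'a) \<Rightarrow> 'a set" where
  "hyperrange S = (\<Inter>n. range (S ^^ n))"

text \<open>
  What upper and lower semi-Fredholm operators share: the powers have closed range, and the
  intersections of the kernel with the ranges of the powers are eventually constant.  The second
  property makes the kernel of \<open>S\<close> on \<open>R(S\<^sup>m)\<close> a part of the hyperrange.
\<close>

locale eventually_uniform_op = bounded_op +
  fixes m :: nat
  assumes closed_range_funpow: "\<And>n. closed (range (S ^^ n))"
    and stable: "\<And>n. n \<ge> m \<Longrightarrow> null_space S \<inter> range (S ^^ n) \<subseteq> range (S ^^ Suc n)"
begin

lemma null_space_Int_range_subset_hyperrange: "null_space S \<inter> range (S ^^ m) \<subseteq> hyperrange S"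
proof -
  have "null_space S \<inter> range (S ^^ m) \<subseteq> range (S ^^ n)" for n
  proof (cases "n \<le> m")
    case True
    then show ?thesis using range_funpow_antimono by blast
  next
    case False
    then have "m \<le> n" by simp
    then show ?thesis
    proof (induction n rule: dec_induct)
      case (step n)
      then show ?case using stable[of n] by blast
    qed simp
  qed
  then show ?thesis unfolding hyperrange_def by blast
qed

lemma hyperrange_subset: "hyperrange S \<subseteq> range (S ^^ n)"
  unfolding hyperrange_def by blast

lemma closed_hyperrange: "closed (hyperrange S)"
  unfolding hyperrange_def using closed_range_funpow by blast

lemma csubspace_range_funpow: "cvs.subspace (range (S ^^ n))"
  by (rule bounded_op.csubspace_range[OF bounded_op_funpow])

lemma csubspace_hyperrange: "cvs.subspace (hyperrange S)"
  unfolding hyperrange_def using csubspace_range_funpow by (intro cvs.subspace_Inter) auto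

text \<open>
  Preimages in \<open>R(S\<^sup>m)\<close> and in a smaller \<open>R(S\<^sup>n)\<close> of the same point differ by an element of
  \<open>N(S) \<inter> R(S\<^sup>m)\<close>, which lies in every range; so the former belong to every \<open>R(S\<^sup>n)\<close> too.
\<close>

lemma image_hyperrange: "S ` hyperrange S = hyperrange S"
proof
  have "S x \<in> range (S ^^ n)" if "x \<in> hyperrange S" for x n
  proof -
    have "S x \<in> range (S ^^ Suc n)"
      unfolding range_funpow_Suc using that hyperrange_subset by blast
    then show ?thesis using range_funpow_antimono[of n "Suc n"] by auto
  qed
  then show "S ` hyperrange S \<subseteq> hyperrange S" unfolding hyperrange_def by blast
next
  show "hyperrange S \<subseteq> S ` hyperrange S"
  proof
    fix x assume x: "x \<in> hyperrange S"
    have pre: "\<exists>u\<in>range (S ^^ n). S u = x" for n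
      using x hyperrange_subset[of "Suc n"] unfolding range_funpow_Suc by blast
    then obtain u where u: "u \<in> range (S ^^ m)" "S u = x" by blast
    have "u \<in> range (S ^^ n)" for n
    proof (cases "n \<le> m")
      case True
      then show ?thesis using u range_funpow_antimono by blast
    next
      case False
      obtain v where v: "v \<in> range (S ^^ n)" "S v = x" using pre by blast
      then have "v \<in> range (S ^^ m)" using False range_funpow_antimono[of m n] by auto
      then have "u - v \<in> null_space S \<inter> range (S ^^ m)"
        using u v cvs.subspace_diff[OF csubspace_range_funpow] by (auto simp: null_space_def diff)
      then have "u - v \<in> range (S ^^ n)"
        using null_space_Int_range_subset_hyperrange hyperrange_subset by blast
      from cvs.subspace_add[OF csubspace_range_funpow v(1) this] show ?thesis
        by simp
    qed
    then show "x \<in> S ` hyperrange S" using u(2) unfolding hyperrange_def by blast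
  qed
qed

text \<open>
  A kernel vector in the hyperrange has an infinite chain of preimages with geometric growth, and
  the perturbation series turns it into a kernel vector of \<open>S - e\<close>.
\<close>

lemma infinite_ascent_imp_shift_not_inj:
  assumes "null_space (S ^^ Suc m) \<noteq> null_space (S ^^ m)"
  shows "\<forall>\<^sub>F e in at 0. \<not> inj (shift S e)"
proof -
  obtain v where "v \<in> null_space (S ^^ Suc m)" "v \<notin> null_space (S ^^ m)"
    using assms null_space_funpow_mono[of m "Suc m"] by auto
  then have "(S ^^ m) v \<in> null_space S \<inter> range (S ^^ m)" and y0: "(S ^^ m) v \<noteq> 0"
    by (auto simp: null_space_def)
  then have y: "(S ^^ m) v \<in> hyperrange S" "S ((S ^^ m) v) = 0"
    using null_space_Int_range_subset_hyperrange by (auto simp: null_space_def)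
  define y where "y = (S ^^ m) v"
  note y = y[folded y_def] y0[folded y_def]
  have "closed (S ` hyperrange S)" using closed_hyperrange image_hyperrange by simp
  from open_mapping_closed_subspace[OF bounded_linear csubspace_imp_subspace[OF csubspace_hyperrange]
      closed_hyperrange this]
  obtain C where C: "C > 0" "\<forall>w\<in>hyperrange S. \<exists>u\<in>hyperrange S. S u = w \<and> norm u \<le> C * norm w"
    unfolding image_hyperrange by blast
  then obtain h where h: "\<And>w. w \<in> hyperrange S \<Longrightarrow> h w \<in> hyperrange S"
    "\<And>w. w \<in> hyperrange S \<Longrightarrow> S (h w) = w" "\<And>w. w \<in> hyperrange S \<Longrightarrow> norm (h w) \<le> C * norm w"
    by metis
  have hn: "(h ^^ n) y \<in> hyperrange S" for n
    by (induction n) (use y h in auto)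
  have I: "bounded_op (\<lambda>x :: 'a. x)"
    by unfold_locales (simp add: bounded_operator_def bounded_linear_ident)
  \<comment> \<open>With \<open>C * cmod e\<close> below \<open>1 / 2\<close> the series differs from \<open>y\<close> by less than \<open>norm y\<close>, so it is
    not zero.\<close>
  have "\<not> inj (shift S e)" if e: "(2 * C) * cmod e < 1" for e
  proof -
    define r where "r = C * cmod e"
    have r: "0 \<le> r" "2 * r < 1" using e C(1) by (simp_all add: r_def mult.assoc)
    have hS: "S ((h ^^ Suc n) y) = (h ^^ n) y" and hN: "norm ((h ^^ Suc n) y) \<le> C * norm ((h ^^ n) y)" for n
      using h(2,3)[OF hn[of n]] by simp_all
    have "C \<ge> 0" "C * cmod e < 1" using C(1) r by (auto simp: r_def)
    from perturbation_series[OF bounded_op_axioms I csubspace_hyperrange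
        closed_hyperrange, of "\<lambda>n. (h ^^ n) y" C e, OF hn hS hN this]
    obtain z where z: "S z - e *\<^sub>C z = S y"
        "norm (z - y) \<le> C * cmod e * norm y / (1 - C * cmod e)"
      unfolding funpow_0 by metis
    have "z \<noteq> 0"
    proof
      assume z0: "z = 0"
      have "norm y \<le> r * norm y / (1 - r)"
        using z(2) by (simp only: z0 r_def diff_0 norm_minus_cancel)
      then have "norm y * (1 - r) \<le> r * norm y"
        using pos_le_divide_eq[of "1 - r" "norm y" "r * norm y"] r by linarith
      then have "norm y * (1 - 2 * r) \<le> 0" by (simp add: algebra_simps)
      moreover have "norm y * (1 - 2 * r) > 0" using y(3) r(2) by (intro mult_pos_pos) auto
      ultimately show False by linarith
    qed
    moreover have "shift S e z = shift S e 0"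
      using z(1) y(2) by (simp add: shift_def zero)
    ultimately show ?thesis by (metis injD)
  qed
  then show ?thesis
    using eventually_at_0_small[of "2 * C"] C(1) by (auto elim: eventually_mono)
qed

text \<open>
  On \<open>Y = R(S\<^sup>m)\<close> modulo the hyperrange \<open>U\<close>, \<open>S\<close> is bounded below: the kernel of \<open>S\<close> on \<open>Y\<close> lies in
  \<open>U = S U\<close>.  If \<open>S - e\<close> is surjective and \<open>e\<close> is small compared to the lower bound, every \<open>y \<in> Y\<close> is
  \<open>(S - e) x\<close> with \<open>x \<in> Y\<close> controlled by \<open>y\<close>, so that \<open>S x\<close> approximates \<open>y\<close> up to half of its
  norm; hence \<open>S Y\<close>, being closed, is all of \<open>Y\<close>.
\<close>

lemma frequently_shift_surj_imp_finite_descent: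
  assumes freq: "\<exists>\<^sub>F e in at 0. range (shift S e) = UNIV"
  shows "range (S ^^ Suc m) = range (S ^^ m)"
proof -
  define Y where "Y = range (S ^^ m)"
  define U where "U = hyperrange S"
  have Y: "cvs.subspace Y" "closed Y" "U \<subseteq> Y"
    unfolding Y_def U_def using csubspace_range_funpow closed_range_funpow hyperrange_subset by auto
  have U: "cvs.subspace U" "S ` U = U"
    unfolding U_def using csubspace_hyperrange image_hyperrange by blast+
  have SY: "S ` Y = range (S ^^ Suc m)" unfolding Y_def by (rule range_funpow_Suc[symmetric])
  have SYc: "closed (S ` Y)" unfolding SY by (rule closed_range_funpow)
  have USY: "U \<subseteq> S ` Y" unfolding U_def SY by (rule hyperrange_subset)
  have SYY: "S ` Y \<subseteq> Y" unfolding SY unfolding Y_def by (rule range_funpow_antimono) simp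
  have kerU: "x \<in> U" if "x \<in> Y" "S x = 0" for x
    using that null_space_Int_range_subset_hyperrange by (auto simp: U_def Y_def null_space_def)
  from open_mapping_closed_subspace[OF bounded_linear csubspace_imp_subspace[OF Y(1)] Y(2) SYc]
  obtain C where C: "C > 0" "\<forall>w\<in>S ` Y. \<exists>u\<in>Y. S u = w \<and> norm u \<le> C * norm w"
    by blast
  define d where "d x = infdist x U" for x
  have d_nonneg: "d x \<ge> 0" for x unfolding d_def by (rule infdist_nonneg)
  have lower: "d x \<le> C * d (S x)" if x: "x \<in> Y" for x
  proof -
    have "d x / C \<le> dist (S x) v" if v: "v \<in> U" for v
    proof -
      obtain w where w: "w \<in> U" "S w = v" using v U(2) by (metis imageE)
      have "x - w \<in> Y" using x w Y cvs.subspace_diff by blast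
      then have "S x - v \<in> S ` Y" using w(2) by (metis diff image_eqI)
      then obtain u where u: "u \<in> Y" "S u = S x - v" "norm u \<le> C * norm (S x - v)"
        using C(2) by blast
      have "x - w - u \<in> U"
        using \<open>x - w \<in> Y\<close> u w(2) Y(1) by (intro kerU) (auto simp: diff cvs.subspace_diff)
      then have "x - u \<in> U" using cvs.subspace_add[OF U(1) _ w(1), of "x - w - u"] by (simp add: algebra_simps)
      then have "d x \<le> dist x (x - u)" unfolding d_def by (rule infdist_le)
      also have "\<dots> \<le> C * dist (S x) v" using u(3) by (simp add: dist_norm)
      finally show ?thesis using C(1) by (simp add: field_simps)
    qed
    then have "d x / C \<le> d (S x)"
      unfolding d_def by (rule infdist_csubspace_greatest[OF U(1)])
    then show ?thesis using C(1) by (simp add: field_simps)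
  qed
  \<comment> \<open>The bound on \<open>e\<close> lets the lower bound absorb the term \<open>e x\<close>, which leaves
    \<open>d x \<le> 2 * C * d y\<close>, and makes the resulting error \<open>d (e x)\<close> at most \<open>d y / 2\<close>.\<close>
  obtain e where e: "range (shift S e) = UNIV" "(4 * C) * cmod e < 1"
    using frequently_ex[OF frequently_eventually_conj[OF freq eventually_at_0_small[of "4 * C"]]] C(1) by auto
  have "infdist y (S ` Y) \<le> norm y / 2" if y: "y \<in> Y" for y
  proof -
    obtain t where t: "y = (S ^^ m) t" using y unfolding Y_def by blast
    obtain s where "t = shift S e s" using e(1) by (metis UNIV_I rangeE)
    then have "y = shift S e ((S ^^ m) s)" using t by (simp add: funpow_shift)
    then obtain x where x: "x \<in> Y" "y = S x - e *\<^sub>C x" unfolding Y_def shift_def by blast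
    have "d (S x) \<le> d y + cmod e * d x"
      using infdist_csubspace_add_le[OF U(1), of y "e *\<^sub>C x"]
        infdist_csubspace_scaleC_le[OF U(1), of e x] x(2) by (simp add: d_def)
    then have "C * d (S x) \<le> C * d y + C * cmod e * d x"
      using mult_left_mono[of _ _ C] C(1) by (fastforce simp: algebra_simps)
    moreover have "C * cmod e * d x \<le> d x / 4"
      using mult_right_mono[of "4 * C * cmod e" 1 "d x"] e(2) d_nonneg[of x] by simp
    ultimately have dx: "d x \<le> 2 * C * d y"
      using lower[OF x(1)] d_nonneg[of x] by simp
    have "d (y - S x) = d ((- e) *\<^sub>C x)" using x(2) by simp
    also have "\<dots> \<le> cmod e * d x"
      using infdist_csubspace_scaleC_le[OF U(1), of "- e" x] by (simp add: d_def)
    also have "\<dots> \<le> cmod e * (2 * C * d y)"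
      using dx by (intro mult_left_mono) auto
    also have "\<dots> \<le> d y / 2"
      using mult_right_mono[of "4 * C * cmod e" 1 "d y"] e(2) d_nonneg[of y]
      by (simp add: algebra_simps)
    also have "\<dots> \<le> norm y / 2"
      using infdist_le[OF cvs.subspace_0[OF U(1)], of y] by (simp add: d_def)
    finally have "d (y - S x) \<le> norm y / 2" .
    moreover have "infdist y (S ` Y) \<le> infdist (y - S x) (S ` Y) + infdist (S x) (S ` Y)"
      using infdist_csubspace_add_le[OF csubspace_image[OF Y(1)], of "y - S x" "S x"] by simp
    moreover have "infdist (y - S x) (S ` Y) \<le> d (y - S x)"
      unfolding d_def using USY cvs.subspace_0[OF U(1)] by (intro infdist_mono) auto
    ultimately show ?thesis using x(1) by simp
  qed
  then have "Y \<subseteq> S ` Y"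
    by (rule subset_closed_csubspace_if_infdist_half[OF csubspace_image[OF Y(1)] SYc Y(1) SYY])
  then show ?thesis using SYY SY unfolding Y_def by blast
qed

end

section \<open>Finite-dimensional linear algebra\<close>

definition finite_dim :: "'a :: complex_banach set \<Rightarrow> bool" where
  "finite_dim V \<longleftrightarrow> (\<exists>B. finite B \<and> V \<subseteq> cvs.span B)"

lemma cdim_finite_dim: "finite_dim V \<Longrightarrow> cdim V = enat (cvs.dim V)"
  unfolding cdim_def finite_dim_def by simp

lemma cdim_less_infinity_iff: "cdim V < \<infinity> \<longleftrightarrow> finite_dim V"
  unfolding cdim_def finite_dim_def by simp

lemma finite_dim_subset: "finite_dim W \<Longrightarrow> V \<subseteq> W \<Longrightarrow> finite_dim V"
  unfolding finite_dim_def by blast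

lemma finite_dim_basis:
  assumes "cvs.subspace V" "finite_dim V"
  obtains D where "finite D" "cvs.independent D" "cvs.span D = V" "card D = cvs.dim V"
proof -
  obtain D where D: "D \<subseteq> V" "cvs.independent D" "V \<subseteq> cvs.span D" "card D = cvs.dim V"
    using cvs.basis_exists by metis
  obtain B where B: "finite B" "V \<subseteq> cvs.span B" using assms(2) unfolding finite_dim_def by blast
  have "finite D" using cvs.independent_span_bound[OF B(1) D(2) subset_trans[OF D(1) B(2)]] by simp
  moreover have "cvs.span D = V"
    using cvs.span_minimal[OF D(1) assms(1)] D(3) by (rule subset_antisym)
  ultimately show thesis using that D by blast
qed

lemma finite_dim_closed: "cvs.subspace V \<Longrightarrow> finite_dim V \<Longrightarrow> closed V"
  unfolding finite_dim_def by (auto intro: closed_csubspace_finite_dim)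

lemma dim_mono_finite_dim:
  assumes "V \<subseteq> W" "cvs.subspace W" "finite_dim W"
  shows "cvs.dim V \<le> cvs.dim W"
proof -
  obtain E where "finite E" "cvs.independent E" "cvs.span E = W" "card E = cvs.dim W"
    using finite_dim_basis[OF assms(2,3)] by metis
  then show ?thesis using assms(1) cvs.dim_le_card[of V E] by simp
qed

lemma finite_dim_subspace_eqI:
  assumes "V \<subseteq> W" "cvs.subspace V" "cvs.subspace W" "finite_dim W" "cvs.dim W \<le> cvs.dim V"
  shows "V = W"
proof (rule ccontr)
  assume "V \<noteq> W"
  then obtain w where w: "w \<in> W" "w \<notin> V" using assms(1) by blast
  obtain D where D: "finite D" "cvs.independent D" "cvs.span D = V" "card D = cvs.dim V"
    using finite_dim_basis[OF assms(2) finite_dim_subset[OF assms(4,1)]] by metis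
  obtain E where E: "finite E" "cvs.independent E" "cvs.span E = W" "card E = cvs.dim W"
    using finite_dim_basis[OF assms(3,4)] by metis
  have "cvs.independent (insert w D)" using D w by (intro cvs.independent_insertI) auto
  moreover have "insert w D \<subseteq> cvs.span E"
    using w(1) assms(1) cvs.span_superset[of D] unfolding D(3) E(3) by simp
  ultimately have "card (insert w D) \<le> card E" using cvs.independent_span_bound[OF E(1)] by blast
  moreover have "w \<notin> D" using w(2) cvs.span_superset[of D] unfolding D(3) by (rule contra_subsetD[rotated])
  ultimately show False using D E assms(5) by simp
qed

lemma independent_span_Int_Diff:
  assumes "cvs.independent B" "A \<subseteq> B"
  shows "cvs.span A \<inter> cvs.span (B - A) \<subseteq> {0}"
proof safe
  fix v assume v: "v \<in> cvs.span A" "v \<in> cvs.span (B - A)"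
  have "cvs.representation B v = cvs.representation A v"
    "cvs.representation B v = cvs.representation (B - A) v"
    using v assms by (auto intro: cvs.representation_extend)
  then have "cvs.representation B v b = 0" for b
    by (metis Diff_iff cvs.representation_ne_zero)
  moreover have "v \<in> cvs.span B" using v(1) assms(2) cvs.span_mono by blast
  ultimately show "v = 0"
    using cvs.sum_nonzero_representation_eq[OF assms(1), of v] by simp
qed

lemma csubspace_kernel_on:
  assumes "Vector_Spaces.linear scaleC scaleC f" "cvs.subspace V"
  shows "cvs.subspace {x \<in> V. f x = 0}"
proof -
  have "{x \<in> V. f x = 0} = V \<inter> {x. f x = 0}" by blast
  then show ?thesis
    using cvs.subspace_inter[OF assms(2) cvp.linear_subspace_kernel[OF assms(1)]] by simp
qed

lemma finite_dim_image:
  assumes f: "Vector_Spaces.linear scaleC scaleC f" and fin: "finite_dim V"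
  shows "finite_dim (f ` V)"
proof -
  obtain B where B: "finite B" "V \<subseteq> cvs.span B" using fin unfolding finite_dim_def by blast
  have "f ` V \<subseteq> cvs.span (f ` B)"
    unfolding cvp.linear_span_image[OF f] using B(2) by (rule image_mono)
  then show ?thesis
    unfolding finite_dim_def using B(1) by blast
qed

lemma finite_dim_from_kernel_image:
  assumes f: "Vector_Spaces.linear scaleC scaleC f" and V: "cvs.subspace V"
    and K: "finite_dim {x \<in> V. f x = 0}" and R: "finite_dim (f ` V)"
  shows "finite_dim V"
proof -
  obtain D where D: "finite D" "{x \<in> V. f x = 0} \<subseteq> cvs.span D"
    using K unfolding finite_dim_def by blast
  obtain E where E: "finite E" "cvs.span E = f ` V"
    using finite_dim_basis[OF cvp.linear_subspace_image[OF f V] R] by metis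
  then have "E \<subseteq> f ` V" using cvs.span_superset[of E] by simp
  then obtain F where F: "F \<subseteq> V" "finite F" "E = f ` F"
    using finite_subset_image[OF E(1)] by metis
  have "V \<subseteq> cvs.span (D \<union> F)"
  proof
    fix x assume x: "x \<in> V"
    then have "f x \<in> f ` cvs.span F"
      unfolding cvp.linear_span_image[OF f, of F, symmetric] F(3)[symmetric] E(2) by (rule imageI)
    then obtain e where e: "e \<in> cvs.span F" "f x = f e" by blast
    have "e \<in> V" using cvs.span_minimal[OF F(1) V] e(1) by (rule subsetD)
    then have "x - e \<in> {x \<in> V. f x = 0}"
      using x e V by (simp add: cvs.subspace_diff cvp.linear_diff[OF f])
    then have "x - e \<in> cvs.span D" by (rule subsetD[OF D(2)])
    then have "(x - e) + e \<in> cvs.span (D \<union> F)"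
      using e(1) cvs.span_mono[of D "D \<union> F"] cvs.span_mono[of F "D \<union> F"] by (intro cvs.span_add) auto
    then show "x \<in> cvs.span (D \<union> F)" by simp
  qed
  then show ?thesis unfolding finite_dim_def using D(1) F(2) by blast
qed

lemma rank_nullity:
  assumes f: "Vector_Spaces.linear scaleC scaleC f" and V: "cvs.subspace V" "finite_dim V"
  shows "cvs.dim V = cvs.dim {x \<in> V. f x = 0} + cvs.dim (f ` V)"
proof -
  define K where "K = {x \<in> V. f x = 0}"
  have K: "cvs.subspace K" "K \<subseteq> V" unfolding K_def using csubspace_kernel_on[OF f V(1)] by auto
  obtain A where A: "finite A" "cvs.independent A" "cvs.span A = K" "card A = cvs.dim K"
    using finite_dim_basis[OF K(1) finite_dim_subset[OF V(2) K(2)]] by metis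
  have "A \<subseteq> V" using cvs.span_superset[of A] K(2) unfolding A(3) by (rule subset_trans)
  then obtain B where B: "A \<subseteq> B" "B \<subseteq> V" "cvs.independent B" "V \<subseteq> cvs.span B"
    using cvs.maximal_independent_subset_extend[OF _ A(2)] by metis
  obtain E where E: "finite E" "V \<subseteq> cvs.span E" using V(2) unfolding finite_dim_def by blast
  have fB: "finite B" using cvs.independent_span_bound[OF E(1) B(3) subset_trans[OF B(2) E(2)]] by simp
  have inj: "inj_on f (cvs.span (B - A))"
  proof (rule inj_onI)
    fix x y assume xy: "x \<in> cvs.span (B - A)" "y \<in> cvs.span (B - A)" "f x = f y"
    then have d: "x - y \<in> cvs.span (B - A)" by (simp add: cvs.span_diff)
    have "cvs.span (B - A) \<subseteq> V" using B(2) V(1) by (intro cvs.span_minimal) auto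
    then have "x - y \<in> K" unfolding K_def using d xy(3) cvp.linear_diff[OF f] by auto
    then have "x - y \<in> cvs.span A \<inter> cvs.span (B - A)" using d unfolding A(3) by (rule IntI)
    then have "x - y \<in> {0}" by (rule subsetD[OF independent_span_Int_Diff[OF B(3,1)]])
    then show "x = y" by simp
  qed
  have "cvs.independent (f ` (B - A))"
    by (rule cvp.linear_independent_injective_image[OF f cvs.independent_mono[OF B(3)] inj]) auto
  moreover have "f ` V \<subseteq> cvs.span (f ` (B - A))"
  proof -
    have "f ` V \<subseteq> f ` cvs.span B" using B(4) by (rule image_mono)
    also have "\<dots> = cvs.span (f ` B)" by (rule cvp.linear_span_image[OF f, symmetric])
    also have "\<dots> \<subseteq> cvs.span (f ` (B - A))"
    proof (rule cvs.span_minimal)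
      have "f b \<in> cvs.span (f ` (B - A))" if "b \<in> B" for b
      proof (cases "b \<in> A")
        case True
        then have "b \<in> K" using A(3) cvs.span_base by metis
        then have "f b = 0" by (simp add: K_def)
        then show ?thesis by (simp add: cvs.span_zero)
      next
        case False
        then show ?thesis using that by (intro cvs.span_base) auto
      qed
      then show "f ` B \<subseteq> cvs.span (f ` (B - A))" by blast
    qed simp
    finally show ?thesis .
  qed
  moreover have "f ` (B - A) \<subseteq> f ` V" using B(2) by blast
  moreover have "card (f ` (B - A)) = card (B - A)"
    by (rule card_image[OF inj_on_subset[OF inj cvs.span_superset]])
  ultimately have dfV: "cvs.dim (f ` V) = card (B - A)"
    by (intro cvs.dim_unique)
  have dV: "cvs.dim V = card B"
    by (rule cvs.dim_unique[OF B(2,4,3) refl])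
  have "card B = card A + card (B - A)"
    using card_Diff_subset[OF A(1) B(1)] card_mono[OF fB B(1)] by simp
  then show ?thesis using A(4) unfolding dfV dV K_def by simp
qed

text \<open>
  The quotient by a subspace \<open>V\<close> is modelled by the range of a linear projection with kernel \<open>V\<close>.
\<close>

definition quotient_projection :: "'a :: complex_banach set \<Rightarrow> ('a \<Rightarrow> 'a) \<Rightarrow> bool" where
  "quotient_projection V p \<longleftrightarrow>
     Vector_Spaces.linear scaleC scaleC p \<and> (\<forall>x. p x = 0 \<longleftrightarrow> x \<in> V) \<and> (\<forall>x. p (p x) = p x)"

lemma quotient_projection_exists:
  assumes V: "cvs.subspace V"
  shows "\<exists>p. quotient_projection V p"
proof -
  obtain W where "ccomplement V W" using ccomplement_exists[OF V] by blast
  then have W: "cvs.subspace W" "V \<inter> W = {0}" "\<And>x. x \<in> {v + w |v w. v \<in> V \<and> w \<in> W}"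
    unfolding ccomplement_def by auto
  have "\<exists>w. w \<in> W \<and> x - w \<in> V" for x using W(3)[of x] by auto
  then obtain p where p: "\<And>x. p x \<in> W" "\<And>x. x - p x \<in> V" by metis
  have uniq: "p x = u" if "u \<in> W" "x - u \<in> V" for x u
  proof -
    have "p x - u \<in> W" using p that W(1) cvs.subspace_diff by blast
    moreover have "(x - u) - (x - p x) \<in> V" using p that V cvs.subspace_diff by blast
    ultimately have "p x - u \<in> V \<inter> W" by simp
    then show ?thesis using W(2) by simp
  qed
  have "Vector_Spaces.linear scaleC scaleC p"
    unfolding Vector_Spaces.linear_iff
  proof (intro conjI allI)
    fix x y
    have "(x - p x) + (y - p y) \<in> V" using p V cvs.subspace_add by blast
    then show "p (x + y) = p x + p y"
      by (intro uniq) (simp_all add: p W cvs.subspace_add algebra_simps)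
  next
    fix c x
    have "c *\<^sub>C (x - p x) \<in> V" using p V cvs.subspace_scale by blast
    then show "p (c *\<^sub>C x) = c *\<^sub>C p x"
      by (intro uniq) (simp_all add: p W cvs.subspace_scale cvs.scale_right_diff_distrib)
  qed (rule cvs.vector_space_axioms)+
  moreover have "p x = 0 \<longleftrightarrow> x \<in> V" for x
    using p(2)[of x] uniq[of 0 x] cvs.subspace_0[OF W(1)] by auto
  moreover have "p (p x) = p x" for x
    using uniq[of "p x" "p x"] p(1) cvs.subspace_0[OF V] by simp
  ultimately show ?thesis unfolding quotient_projection_def by blast
qed

context
  fixes V :: "'a :: complex_banach set" and p
  assumes p: "quotient_projection V p"
begin

lemma quotient_projection_linear: "Vector_Spaces.linear scaleC scaleC p"
  and quotient_projection_eq_0_iff: "p x = 0 \<longleftrightarrow> x \<in> V"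
  and quotient_projection_idem: "p (p x) = p x"
  using p unfolding quotient_projection_def by auto

lemma quotient_projection_eq_iff: "p x = p y \<longleftrightarrow> x - y \<in> V"
  using cvp.linear_diff[OF quotient_projection_linear, of x y]
  by (simp flip: quotient_projection_eq_0_iff)

lemma csubspace_range_quotient_projection: "cvs.subspace (range p)"
  by (rule cvp.linear_subspace_image[OF quotient_projection_linear]) simp

lemma ccomplement_range_quotient_projection: "ccomplement V (range p)"
  unfolding ccomplement_def
proof (intro conjI csubspace_range_quotient_projection)
  show "V \<inter> range p = {0}"
    using quotient_projection_eq_0_iff quotient_projection_idem
      cvp.linear_0[OF quotient_projection_linear] by (auto simp: image_iff) metis+
  have "x - p x \<in> V" for x using quotient_projection_eq_iff quotient_projection_idem by metis
  then have "\<exists>v w. x = v + w \<and> v \<in> V \<and> w \<in> range p" for x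
    by (intro exI[of _ "x - p x"] exI[of _ "p x"]) auto
  then show "{v + w |v w. v \<in> V \<and> w \<in> range p} = UNIV" by blast
qed

lemma ccodim_quotient_projection:
  assumes "cvs.subspace V"
  shows "ccodim V = cdim (range p)"
  by (rule ccodim_eq[OF assms ccomplement_range_quotient_projection])

lemma finite_dim_range_quotient_projection:
  assumes "finite B" "cvs.span (B \<union> V) = UNIV"
  shows "finite_dim (range p)"
proof -
  have "p ` (B \<union> V) \<subseteq> insert 0 (p ` B)" using quotient_projection_eq_0_iff by auto
  then have "cvs.span (p ` (B \<union> V)) \<subseteq> cvs.span (insert 0 (p ` B))" by (rule cvs.span_mono)
  moreover have "cvs.span (p ` (B \<union> V)) = range p"
    using cvp.linear_span_image[OF quotient_projection_linear, of "B \<union> V"] assms(2) by simp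
  ultimately show ?thesis
    unfolding finite_dim_def using assms(1) by (intro exI[of _ "insert 0 (p ` B)"]) auto
qed

lemma finite_codim_spanning:
  assumes "finite_dim (range p)"
  shows "\<exists>B. finite B \<and> cvs.span (B \<union> V) = UNIV"
proof -
  obtain B where B: "finite B" "range p \<subseteq> cvs.span B" using assms unfolding finite_dim_def by blast
  have "x \<in> cvs.span (B \<union> V)" for x
  proof -
    have "x - p x \<in> V" using quotient_projection_eq_iff quotient_projection_idem by metis
    then have "(x - p x) + p x \<in> cvs.span (B \<union> V)"
      using B(2) cvs.span_mono[of B "B \<union> V"] cvs.span_superset[of "B \<union> V"] by (intro cvs.span_add) auto
    then show ?thesis by simp
  qed
  then show ?thesis using B(1) by blast
qed

end

section \<open>Semi-Fredholm operators are eventually uniform\<close>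

context bounded_op
begin

text \<open>
  The set \<open>M + N(S)\<close> is closed, has the same image as \<open>M\<close>, and is saturated, so the open mapping
  theorem for \<open>S\<close> transports its closedness to the image.
\<close>

lemma closed_image_finite_nullity:
  assumes R: "closed (range S)" and N: "finite_dim (null_space S)"
    and M: "cvs.subspace M" "closed M"
  shows "closed (S ` M)"
proof -
  obtain D where D: "finite D" "cvs.span D = null_space S"
    using finite_dim_basis[OF csubspace_null_space N] by metis
  define M' where "M' = cvs.span (D \<union> M)"
  have M': "cvs.subspace M'" "closed M'" "M \<subseteq> M'" "null_space S \<subseteq> M'"
    unfolding M'_def using closed_span_Un_finite[OF M D(1)] cvs.span_superset[of "D \<union> M"]
      cvs.span_mono[of D "D \<union> M"] D(2) by auto
  have "cvs.span M = M" using M(1) by simp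
  have SM': "S ` M' \<subseteq> S ` M"
  proof safe
    fix x assume "x \<in> M'"
    then have "x \<in> {a + b |a b. a \<in> null_space S \<and> b \<in> cvs.span M}"
      unfolding M'_def cvs.span_Un D(2) .
    then obtain a b where "x = a + b" "S a = 0" "b \<in> M"
      unfolding \<open>cvs.span M = M\<close> null_space_def by blast
    then show "S x \<in> S ` M" by (simp add: add)
  qed
  obtain C where C: "C > 0" "\<forall>y\<in>range S. \<exists>x\<in>UNIV. S x = y \<and> norm x \<le> C * norm y"
    using open_mapping_closed_subspace[OF bounded_linear subspace_UNIV closed_UNIV R]
    by (elim exE conjE) (rule that)
  show ?thesis
    unfolding closed_sequential_limits
  proof (intro allI impI, elim conjE)
    fix y :: "nat \<Rightarrow> 'a" and l assume y: "\<forall>n. y n \<in> S ` M" and l: "y \<longlonglongrightarrow> l"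
    have "\<exists>k. k \<in> M \<and> y n = S k" for n using y[rule_format, of n] by auto
    then obtain k where k: "\<And>n. k n \<in> M" "\<And>n. y n = S (k n)" by metis
    have "l \<in> range S" using closed_sequentially[OF R _ l] k by auto
    then obtain x where x: "l = S x" by blast
    have "y n - l \<in> range S" for n using k x by (metis diff rangeI)
    then have "\<exists>u. S u = y n - l \<and> norm u \<le> C * norm (y n - l)" for n using C(2) by blast
    then obtain u where u: "\<And>n. S (u n) = y n - l" "\<And>n. norm (u n) \<le> C * norm (y n - l)" by metis
    have "u \<longlonglongrightarrow> 0"
    proof (rule Lim_null_comparison[OF always_eventually])
      show "\<forall>n. norm (u n) \<le> C * norm (y n - l)" using u by simp
      show "(\<lambda>n. C * norm (y n - l)) \<longlonglongrightarrow> 0"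
        using l by (intro tendsto_mult_right_zero tendsto_norm_zero) (simp add: LIM_zero_iff)
    qed
    then have lim: "(\<lambda>n. x + u n) \<longlonglongrightarrow> x" using tendsto_add[of "\<lambda>_. x" x] by fastforce
    have "x + u n \<in> M'" for n
    proof -
      have "x + u n - k n \<in> null_space S"
        unfolding null_space_def using u(1)[of n] k(2)[of n] x by (simp add: add diff)
      then have "(x + u n - k n) + k n \<in> M'"
        using M' k(1) by (intro cvs.subspace_add) auto
      then show ?thesis by simp
    qed
    then have "x \<in> M'" using closed_sequentially[OF M'(2) _ lim] by blast
    then show "l \<in> S ` M" using SM' x by blast
  qed
qed

text \<open>The decreasing subspaces \<open>N(S) \<inter> R(S\<^sup>n)\<close> are finite-dimensional, hence eventually constant.\<close>

lemma eventually_uniform_if_finite_nullity: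
  assumes R: "closed (range S)" and N: "finite_dim (null_space S)"
  shows "\<exists>m. eventually_uniform_op S m"
proof -
  define K where "K n = null_space S \<inter> range (S ^^ n)" for n
  have K: "cvs.subspace (K n)" "finite_dim (K n)" for n
    unfolding K_def using csubspace_null_space bounded_op.csubspace_range[OF bounded_op_funpow] N
    by (auto intro: cvs.subspace_inter finite_dim_subset)
  obtain m where m: "\<And>n. cvs.dim (K m) \<le> cvs.dim (K n)"
    using ex_has_least_nat[of "\<lambda>_. True" 0 "\<lambda>n. cvs.dim (K n)"] by auto
  have Km: "K n = K m" if "m \<le> n" for n
  proof (rule finite_dim_subspace_eqI)
    show "K n \<subseteq> K m" unfolding K_def using range_funpow_antimono[OF that] by blast
  qed (use K m in auto)
  have "null_space S \<inter> range (S ^^ n) \<subseteq> range (S ^^ Suc n)" if "m \<le> n" for n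
  proof -
    have "K n = K (Suc n)" using Km[of n] Km[of "Suc n"] that by simp
    then show ?thesis unfolding K_def by (simp only: Int_lower2)
  qed
  moreover have "closed (range (S ^^ n))" for n
  proof (induction n)
    case (Suc n)
    show ?case
      unfolding range_funpow_Suc
      by (rule closed_image_finite_nullity[OF R N bounded_op.csubspace_range[OF bounded_op_funpow] Suc])
  qed simp
  ultimately have "eventually_uniform_op S m" by unfold_locales
  then show ?thesis by blast
qed

text \<open>
  With a finite-dimensional complement \<open>W\<close> of the range, \<open>(x, w) \<mapsto> S x + w\<close> on \<open>X \<times> W\<close> is an open
  map, and the component in \<open>W\<close> is determined by the value.
\<close>

lemma closed_range_finite_codim:
  assumes p: "quotient_projection (range S) p" and W: "finite_dim (range p)"
  shows "closed (range S)"
proof -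
  note sW = csubspace_range_quotient_projection[OF p]
  have p_id: "p w = w" if "w \<in> range p" for w
    using that quotient_projection_idem[OF p] by auto
  have pS: "p (S x) = 0" for x using quotient_projection_eq_0_iff[OF p] by simp
  have p_add: "p (x + y) = p x + p y" for x y
    by (rule cvp.linear_add[OF quotient_projection_linear[OF p]])
  define f where "f = (\<lambda>q. S (fst q) + snd q)"
  have f: "bounded_linear f"
    unfolding f_def
    by (intro bounded_linear_add bounded_linear_compose[OF bounded_linear bounded_linear_fst] bounded_linear_snd)
  have "subspace (UNIV \<times> range p)"
    using csubspace_imp_subspace[OF sW] by (simp add: subspace_Times)
  moreover have "closed ((UNIV :: 'a set) \<times> range p)"
    by (intro closed_Times finite_dim_closed[OF sW W]) simp
  moreover have fU: "f ` (UNIV \<times> range p) = UNIV"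
  proof -
    have "\<exists>q\<in>UNIV \<times> range p. x = f q" for x
    proof -
      have "x - p x \<in> range S" using quotient_projection_eq_iff[OF p] quotient_projection_idem[OF p] by metis
      then obtain u where "x - p x = S u" by blast
      then have "x = f (u, p x)" by (simp add: f_def algebra_simps)
      then show ?thesis by blast
    qed
    then show ?thesis by blast
  qed
  ultimately have "\<exists>C>0. \<forall>y\<in>f ` (UNIV \<times> range p). \<exists>q\<in>UNIV \<times> range p. f q = y \<and> norm q \<le> C * norm y"
    by (intro open_mapping_closed_subspace[OF f]) auto
  then obtain C where C: "C > 0" "\<forall>y. \<exists>q\<in>UNIV \<times> range p. f q = y \<and> norm q \<le> C * norm y"
    unfolding fU by auto
  have bound: "norm (p y) \<le> C * norm y" for y
  proof -
    obtain q where q: "q \<in> UNIV \<times> range p" "f q = y" "norm q \<le> C * norm y" using C(2) by blast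
    then have "p y = snd q" using p_id[of "snd q"] by (auto simp: f_def p_add pS)
    then show ?thesis using q(3) norm_snd_le[of "snd q" "fst q"] by simp
  qed
  show ?thesis
    unfolding closed_sequential_limits
  proof (intro allI impI, elim conjE)
    fix y l assume y: "\<forall>n. y n \<in> range S" and l: "y \<longlonglongrightarrow> l"
    have "norm (p l) \<le> C * norm (l - y n)" for n
    proof -
      have "p (l - y n) = p l"
        using y quotient_projection_eq_iff[OF p, of "l - y n" l] cvs.subspace_neg[OF csubspace_range] by simp
      then show ?thesis using bound[of "l - y n"] by simp
    qed
    moreover have "(\<lambda>n. C * norm (l - y n)) \<longlonglongrightarrow> 0"
      using tendsto_diff[OF tendsto_const[of l] l] by (intro tendsto_mult_right_zero tendsto_norm_zero) simp
    ultimately have "norm (p l) \<le> 0" by (intro LIMSEQ_le_const) auto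
    then show "l \<in> range S" using quotient_projection_eq_0_iff[OF p] by simp
  qed
qed

lemma finite_codim_range_funpow:
  assumes "finite B" "cvs.span (B \<union> range S) = UNIV"
  shows "\<exists>B. finite B \<and> cvs.span (B \<union> range (S ^^ n)) = UNIV"
proof (induction n)
  case 0
  show ?case by (intro exI[of _ "{}"]) (simp add: cvs.span_UNIV)
next
  case (Suc n)
  then obtain D where D: "finite D" "cvs.span (D \<union> range (S ^^ n)) = UNIV" by blast
  define E where "E = (B \<union> S ` D) \<union> range (S ^^ Suc n)"
  have "range S = cvs.span (S ` D \<union> range (S ^^ Suc n))"
    using cvp.linear_span_image[OF clinear, of "D \<union> range (S ^^ n)"]
    unfolding range_funpow_Suc image_Un D(2) by (rule sym)
  also have "\<dots> \<subseteq> cvs.span E"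
    by (rule cvs.span_mono) (auto simp: E_def)
  finally have "range S \<subseteq> cvs.span E" .
  moreover have "B \<subseteq> cvs.span E"
    using cvs.span_superset[of E] by (auto simp: E_def)
  ultimately have "cvs.span (B \<union> range S) \<subseteq> cvs.span E"
    by (intro cvs.span_minimal cvs.subspace_span Un_least)
  then have "cvs.span E = UNIV" unfolding assms(2) by (rule top_le)
  then show ?case using D(1) assms(1) unfolding E_def by (intro exI[of _ "B \<union> S ` D"]) simp
qed

lemma finite_dim_range_funpow_projection:
  assumes p: "quotient_projection (range S) p" "finite_dim (range p)"
    and q: "quotient_projection (range (S ^^ n)) q"
  shows "finite_dim (range q)"
proof -
  obtain B where B: "finite B" "cvs.span (B \<union> range S) = UNIV"
    using finite_codim_spanning[OF p] by metis
  obtain D where "finite D" "cvs.span (D \<union> range (S ^^ n)) = UNIV"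
    using finite_codim_range_funpow[OF B] by metis
  then show ?thesis by (rule finite_dim_range_quotient_projection[OF q])
qed

text \<open>
  Here the subspaces \<open>N(S) \<inter> R(S\<^sup>n)\<close> may be infinite-dimensional, but the increasing subspaces
  \<open>N(S\<^sup>n) + R(S)\<close> are constant from some \<open>m\<close> on, having finite codimension.  For \<open>n \<ge> m\<close> and
  \<open>S\<^sup>n u \<in> N(S)\<close> this gives \<open>u = v + S w\<close> with \<open>v \<in> N(S\<^sup>m)\<close>, so \<open>S\<^sup>n u = S\<^sup>n\<^sup>+\<^sup>1 w\<close>.
\<close>

lemma eventually_uniform_if_finite_defect:
  assumes p: "quotient_projection (range S) p" and W: "finite_dim (range p)"
  shows "\<exists>m. eventually_uniform_op S m"
proof -
  define P where "P n = p ` null_space (S ^^ n)" for n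
  have sN: "cvs.subspace (null_space (S ^^ n))" for n
    by (rule bounded_op.csubspace_null_space[OF bounded_op_funpow])
  have P: "cvs.subspace (P n)" "P n \<subseteq> range p" "finite_dim (P n)" for n
    unfolding P_def using cvp.linear_subspace_image[OF quotient_projection_linear[OF p] sN] W
    by (auto intro: finite_dim_subset)
  have "cvs.dim (P n) < Suc (cvs.dim (range p))" for n
    using dim_mono_finite_dim[OF P(2) csubspace_range_quotient_projection[OF p] W, of n] by simp
  then obtain m where m: "\<And>n. cvs.dim (P n) \<le> cvs.dim (P m)"
    using ex_has_greatest_nat[of "\<lambda>_. True" 0 "\<lambda>n. cvs.dim (P n)" "Suc (cvs.dim (range p))"]
    by (metis less_imp_le)
  have Pm: "P m = P n" if "m \<le> n" for n
  proof (rule finite_dim_subspace_eqI)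
    show "P m \<subseteq> P n" unfolding P_def using null_space_funpow_mono[OF that] by blast
  qed (use P m in auto)
  have "null_space S \<inter> range (S ^^ n) \<subseteq> range (S ^^ Suc n)" if n: "m \<le> n" for n
  proof
    interpret Sn: bounded_op "S ^^ n" by (rule bounded_op_funpow)
    fix y assume y: "y \<in> null_space S \<inter> range (S ^^ n)"
    then obtain u where u: "y = (S ^^ n) u" "S y = 0" by (auto simp: null_space_def)
    then have "p u \<in> P (Suc n)" unfolding P_def null_space_def by auto
    then have "p u \<in> P m" using Pm[of "Suc n"] n by simp
    then obtain v where v: "v \<in> null_space (S ^^ m)" "p u = p v" unfolding P_def by blast
    then have "(S ^^ n) v = 0" using null_space_funpow_mono[OF n] by (auto simp: null_space_def)
    moreover obtain w where "u - v = S w"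
      using v(2) quotient_projection_eq_iff[OF p] by blast
    ultimately have "y = (S ^^ Suc n) w"
      using u(1) Sn.diff[of u v] by (simp add: funpow_swap1)
    then show "y \<in> range (S ^^ Suc n)" by blast
  qed
  moreover have "closed (range (S ^^ n))" for n
  proof -
    obtain q where q: "quotient_projection (range (S ^^ n)) q"
      using quotient_projection_exists[OF bounded_op.csubspace_range[OF bounded_op_funpow]] by blast
    show ?thesis
      by (rule bounded_op.closed_range_finite_codim[OF bounded_op_funpow q
            finite_dim_range_funpow_projection[OF p W q]])
  qed
  ultimately have "eventually_uniform_op S m" by unfold_locales
  then show ?thesis by blast
qed

end

section \<open>Nullity, defect, ascent and descent\<close>

lemma cdim_eq_0_iff:
  fixes V :: "'a :: complex_banach set"
  assumes "cvs.subspace V"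
  shows "cdim V = 0 \<longleftrightarrow> V = {0}"
proof
  assume 0: "cdim V = 0"
  then have fin: "finite_dim V" by (simp flip: cdim_less_infinity_iff)
  then have "cvs.dim V = 0" using 0 cdim_finite_dim[OF fin] by (simp add: zero_enat_def)
  then have "{0} = V"
    using fin assms cvs.subspace_0[OF assms] by (intro finite_dim_subspace_eqI) auto
  then show "V = {0}" by simp
next
  assume V: "V = {0}"
  have "finite_dim V" unfolding V finite_dim_def by (intro exI[of _ "{}"]) simp
  moreover have "cvs.dim V = 0" unfolding V using cvs.dim_eq_card_independent[OF cvs.independent_empty] cvs.dim_span[of "{} :: 'a set"] by simp
  ultimately show "cdim V = 0" using cdim_finite_dim[of V] by (simp add: zero_enat_def)
qed

lemma index_le_0_iff: "nullity S = enat a \<Longrightarrow> index S \<le> 0 \<longleftrightarrow> nullity S \<le> defect S"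
  unfolding index_def by (cases "defect S") auto

lemma index_ge_0_iff: "defect S = enat b \<Longrightarrow> index S \<ge> 0 \<longleftrightarrow> defect S \<le> nullity S"
  unfolding index_def by (cases "nullity S") auto

context bounded_op
begin

lemma range_projection: "\<exists>p. quotient_projection (range S) p"
  by (rule quotient_projection_exists[OF csubspace_range])

lemma defect_eq: "quotient_projection (range S) p \<Longrightarrow> defect S = cdim (range p)"
  unfolding defect_def using ccodim_quotient_projection[OF _ csubspace_range] .

lemma csubspace_null_space_funpow: "cvs.subspace (null_space (S ^^ n))"
  by (rule bounded_op.csubspace_null_space[OF bounded_op_funpow])

lemma inj_iff_nullity: "inj S \<longleftrightarrow> nullity S = 0"
  unfolding nullity_def cdim_eq_0_iff[OF csubspace_null_space]
  by (auto simp: inj_iff_eq_0 null_space_def zero)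

lemma surj_iff_defect: "range S = UNIV \<longleftrightarrow> defect S = 0"
proof -
  obtain p where p: "quotient_projection (range S) p" using range_projection by blast
  have "range p = {0} \<longleftrightarrow> (\<forall>x. p x = 0)" by auto
  also have "\<dots> \<longleftrightarrow> range S = UNIV" unfolding quotient_projection_eq_0_iff[OF p] by blast
  finally show ?thesis
    unfolding defect_eq[OF p] cdim_eq_0_iff[OF csubspace_range_quotient_projection[OF p]] by simp
qed

lemma invertible_op_iff: "invertible_op S \<longleftrightarrow> inj S \<and> range S = UNIV"
proof
  assume "invertible_op S"
  then obtain R where "R \<circ> S = id" "S \<circ> R = id" unfolding invertible_op_def by blast
  then have "R (S x) = x" "S (R x) = x" for x by (simp_all add: fun_eq_iff)
  then show "inj S \<and> range S = UNIV" by (metis injI surjI)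
next
  assume bij: "inj S \<and> range S = UNIV"
  then have S_inv: "S (inv S x) = x" "inv S (S x) = x" for x by (auto simp: surj_f_inv_f)
  have "closed (range S)" using bij by simp
  from open_mapping_closed_subspace[OF bounded_linear subspace_UNIV closed_UNIV this]
  obtain C where C: "\<forall>y\<in>range S. \<exists>x\<in>UNIV. S x = y \<and> norm x \<le> C * norm y"
    by (elim exE conjE) (rule that)
  have inv_eqI: "inv S y = x" if "S x = y" for x y using that S_inv(2) by blast
  have "bounded_linear (inv S)"
  proof (rule bounded_linear_intro[where K = C])
    show "norm (inv S x) \<le> norm x * C" for x
    proof -
      obtain u where u: "S u = x" "norm u \<le> C * norm x" using C bij by blast
      then show ?thesis using inv_eqI[OF u(1)] by (simp add: mult.commute)
    qed
  qed (auto intro!: inv_eqI simp: add scaleR S_inv)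
  then have "bounded_operator (inv S)"
    unfolding bounded_operator_def by (auto intro!: inv_eqI simp: scaleC S_inv)
  then show "invertible_op S"
    unfolding invertible_op_def using S_inv by (intro exI[of _ "inv S"]) (auto simp: fun_eq_iff)
qed

lemma finite_dim_null_space_funpow:
  assumes N: "finite_dim (null_space S)"
  shows "finite_dim (null_space (S ^^ n))"
proof (induction n)
  case 0
  have "null_space (S ^^ 0) = {0}" by (auto simp: null_space_def)
  then show ?case unfolding finite_dim_def by (intro exI[of _ "{}"]) simp
next
  case (Suc n)
  have "{x \<in> null_space (S ^^ Suc n). S x = 0} \<subseteq> null_space S" by (auto simp: null_space_def)
  moreover have "S ` null_space (S ^^ Suc n) \<subseteq> null_space (S ^^ n)"
    by (auto simp: null_space_def funpow_swap1)
  ultimately show ?case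
    using finite_dim_from_kernel_image[OF clinear csubspace_null_space_funpow] N Suc finite_dim_subset
    by blast
qed

text \<open>
  Apply rank-nullity twice: to the projection \<open>p\<close> onto a complement of the range, restricted to
  \<open>N(S\<^sup>n)\<close>, and to \<open>S : N(S\<^sup>n\<^sup>+\<^sup>1) \<rightarrow> N(S\<^sup>n) \<inter> R(S)\<close>.  The identity ties the growth of the kernels to
  \<open>dim (N(S\<^sup>n) + R(S)) / R(S)\<close>, which in the case of finite defect attains the defect exactly when
  \<open>R(S\<^sup>n\<^sup>+\<^sup>1) = R(S\<^sup>n)\<close>.
\<close>

lemma kernel_growth_balance:
  assumes N: "finite_dim (null_space S)" and p: "quotient_projection (range S) p"
  shows "cvs.dim (p ` null_space (S ^^ n)) + cvs.dim (null_space (S ^^ Suc n)) =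
    cvs.dim (null_space (S ^^ n)) + cvs.dim (null_space S)"
proof -
  note fin = finite_dim_null_space_funpow[OF N]
  have "{x \<in> null_space (S ^^ n). p x = 0} = S ` null_space (S ^^ Suc n)"
    unfolding quotient_projection_eq_0_iff[OF p] by (auto simp: null_space_def funpow_swap1)
  then have 1: "cvs.dim (null_space (S ^^ n)) =
      cvs.dim (S ` null_space (S ^^ Suc n)) + cvs.dim (p ` null_space (S ^^ n))"
    using rank_nullity[OF quotient_projection_linear[OF p] csubspace_null_space_funpow fin, of n] by simp
  have "{x \<in> null_space (S ^^ Suc n). S x = 0} = null_space S"
    by (auto simp: null_space_def funpow_swap1)
  then have "cvs.dim (null_space (S ^^ Suc n)) =
      cvs.dim (null_space S) + cvs.dim (S ` null_space (S ^^ Suc n))"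
    using rank_nullity[OF clinear csubspace_null_space_funpow fin, of "Suc n"] by simp
  with 1 show ?thesis by simp
qed

text \<open>Both sides mean that \<open>N(S\<^sup>n) + R(S)\<close> is the whole space.\<close>

lemma image_null_space_eq_iff:
  assumes p: "quotient_projection (range S) p"
  shows "p ` null_space (S ^^ n) = range p \<longleftrightarrow> range (S ^^ Suc n) = range (S ^^ n)"
proof
  interpret Sn: bounded_op "S ^^ n" by (rule bounded_op_funpow)
  have Suc_eq: "(S ^^ Suc n) u = (S ^^ n) (S u)" for u by (simp add: funpow_swap1)
  {
    assume L: "p ` null_space (S ^^ n) = range p"
    have "(S ^^ n) x \<in> range (S ^^ Suc n)" for x
    proof -
      have "p x \<in> p ` null_space (S ^^ n)" unfolding L by simp
      then obtain v where v: "(S ^^ n) v = 0" "p x = p v" unfolding null_space_def by auto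
      then obtain u where "x - v = S u" using quotient_projection_eq_iff[OF p] by auto
      then have "(S ^^ n) x = (S ^^ Suc n) u" using v(1) Sn.diff[of x v] by (simp add: Suc_eq del: funpow.simps)
      then show ?thesis by (metis rangeI)
    qed
    then show "range (S ^^ Suc n) = range (S ^^ n)"
      using range_funpow_antimono[of n "Suc n"] by (intro subset_antisym) auto
  next
    assume R: "range (S ^^ Suc n) = range (S ^^ n)"
    have "p x \<in> p ` null_space (S ^^ n)" for x
    proof -
      have "(S ^^ n) x \<in> range (S ^^ Suc n)" unfolding R by simp
      then obtain u where "(S ^^ n) x = (S ^^ n) (S u)" unfolding Suc_eq[symmetric] by auto
      then have "x - S u \<in> null_space (S ^^ n)" by (simp add: null_space_def Sn.diff)
      moreover have "p x = p (x - S u)"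
        using quotient_projection_eq_iff[OF p, of x "x - S u"] by simp
      ultimately show ?thesis by blast
    qed
    then show "p ` null_space (S ^^ n) = range p" by blast
  }
qed

section \<open>Browder operators\<close>

lemma browderI:
  assumes "closed (range S)" "finite_dim (null_space S)"
    and "quotient_projection (range S) p" "finite_dim (range p)"
    and "null_space (S ^^ Suc n) = null_space (S ^^ n)" "range (S ^^ Suc n) = range (S ^^ n)"
  shows "browder S"
  unfolding browder_def fredholm_def nullity_def defect_eq[OF assms(3)] cdim_less_infinity_iff
    descent_finite_iff ascent_finite_iff
  using assms by blast

lemma browder_nullity_eq_defect:
  assumes "browder S"
  shows "nullity S = defect S"
proof -
  obtain p where p: "quotient_projection (range S) p" using range_projection by blast
  have N: "finite_dim (null_space S)" and W: "finite_dim (range p)"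
    using assms unfolding browder_def fredholm_def nullity_def defect_eq[OF p] cdim_less_infinity_iff
    by auto
  obtain a where a: "null_space (S ^^ Suc a) = null_space (S ^^ a)"
    using assms unfolding browder_def ascent_finite_iff by blast
  obtain d where d: "range (S ^^ Suc d) = range (S ^^ d)"
    using assms unfolding browder_def descent_finite_iff by blast
  define n where "n = max a d"
  have "null_space (S ^^ Suc n) = null_space (S ^^ n)"
    by (rule null_space_funpow_stable[OF a]) (simp add: n_def)
  moreover have "range (S ^^ Suc n) = range (S ^^ n)"
    by (rule range_funpow_stable[OF d]) (simp add: n_def)
  then have "p ` null_space (S ^^ n) = range p" using image_null_space_eq_iff[OF p] by blast
  ultimately have "cvs.dim (range p) = cvs.dim (null_space S)"
    using kernel_growth_balance[OF N p, of n] by simp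
  then show ?thesis
    unfolding nullity_def defect_eq[OF p] cdim_finite_dim[OF N] cdim_finite_dim[OF W] by simp
qed

lemma browder_closed_range_funpow:
  assumes "browder S"
  shows "closed (range (S ^^ n))"
proof -
  have "closed (range S)" "finite_dim (null_space S)"
    using assms unfolding browder_def fredholm_def nullity_def cdim_less_infinity_iff by auto
  then obtain m where "eventually_uniform_op S m" using eventually_uniform_if_finite_nullity by blast
  then show ?thesis by (rule eventually_uniform_op.closed_range_funpow)
qed

lemma browder_imp_left_drazin_invertible:
  assumes "browder S"
  shows "left_drazin_invertible S"
proof -
  obtain p where "ascent S = enat p" using assms unfolding browder_def by (cases "ascent S") auto
  then show ?thesis
    unfolding left_drazin_invertible_def using browder_closed_range_funpow[OF assms] by blast
qed

lemma left_drazin_invertible_imp_shift_inj: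
  assumes "left_drazin_invertible S"
  shows "\<forall>\<^sub>F e in at 0. inj (shift S e)"
proof -
  obtain p where p: "ascent S = enat p" "closed (range (S ^^ Suc p))"
    using assms unfolding left_drazin_invertible_def by auto
  then have ex: "\<exists>p. null_space (S ^^ p) = null_space (S ^^ (p + 1))"
    and "p = (LEAST p. null_space (S ^^ p) = null_space (S ^^ (p + 1)))"
    unfolding ascent_def by (auto split: if_splits)
  then have "null_space (S ^^ p) = null_space (S ^^ (p + 1))"
    using LeastI_ex[OF ex] by simp
  then have "null_space (S ^^ Suc p) = null_space (S ^^ p)"
    by (simp del: funpow.simps)
  then show ?thesis by (rule finite_ascent_imp_shift_inj[OF _ p(2)])
qed

lemma bounded_below_imp_left_drazin_invertible:
  assumes "inj S" "closed (range S)"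
  shows "left_drazin_invertible S"
proof -
  have eq: "null_space (S ^^ 0) = null_space (S ^^ (0 + 1))"
    using assms(1) by (auto simp: null_space_def inj_iff_eq_0 zero)
  then have "ascent S = enat 0"
    unfolding ascent_def by (metis (mono_tags, lifting) Least_eq_0)
  then show ?thesis unfolding left_drazin_invertible_def using assms(2) by (intro exI[of _ 0]) simp
qed

lemma surj_imp_finite_descent: "range S = UNIV \<Longrightarrow> descent S < \<infinity>"
  unfolding descent_finite_iff by (intro exI[of _ 0]) simp

lemma invertible_imp_browder:
  assumes "invertible_op S"
  shows "browder S"
proof -
  have S: "inj S" "range S = UNIV" using assms by (auto simp: invertible_op_iff)
  obtain p where "ascent S = enat p"
    using bounded_below_imp_left_drazin_invertible[OF S(1)] S(2) unfolding left_drazin_invertible_def by auto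
  moreover have "nullity S = 0" "defect S = 0" using S inj_iff_nullity surj_iff_defect by auto
  ultimately show ?thesis
    using S surj_imp_finite_descent unfolding browder_def fredholm_def by simp
qed

lemma browder_imp_shift_invertible:
  assumes "browder S"
  shows "\<forall>\<^sub>F e in at 0. invertible_op (shift S e)"
proof -
  obtain d where d: "range (S ^^ Suc d) = range (S ^^ d)"
    using assms unfolding browder_def descent_finite_iff by blast
  show ?thesis
    using finite_descent_imp_shift_surj[OF d]
      left_drazin_invertible_imp_shift_inj[OF browder_imp_left_drazin_invertible[OF assms]]
    by eventually_elim (simp add: bounded_op.invertible_op_iff[OF bounded_op_shift])
qed

lemma browder_imp_semi_weyl:
  assumes "browder S"
  shows "upper_semi_weyl S" "lower_semi_weyl S"
proof -
  have *: "closed (range S)" "nullity S < \<infinity>" "defect S < \<infinity>"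
    using assms unfolding browder_def fredholm_def by blast+
  obtain a b where ab: "nullity S = enat a" "defect S = enat b"
    using *(2,3) by (cases "nullity S"; cases "defect S") auto
  have "index S \<le> 0" "index S \<ge> 0"
    using browder_nullity_eq_defect[OF assms] index_le_0_iff[OF ab(1)] index_ge_0_iff[OF ab(2)] by simp_all
  then show "upper_semi_weyl S" "lower_semi_weyl S"
    using * by (auto simp: upper_semi_weyl_def lower_semi_weyl_def upper_semi_fredholm_def lower_semi_fredholm_def)
qed

text \<open>
  Surjective operators arbitrarily close to \<open>S\<close> make the ranges stop decreasing; the dimension
  identity then bounds the defect by the nullity, and equality, which the sign of the index forces,
  makes the kernels stop growing.
\<close>

theorem upper_semi_weyl_browder:
  assumes S: "upper_semi_weyl S" and freq: "\<exists>\<^sub>F e in at 0. range (shift S e) = UNIV"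
  shows "browder S"
proof -
  have R: "closed (range S)" and N: "finite_dim (null_space S)" and ind: "index S \<le> 0"
    using S unfolding upper_semi_weyl_def upper_semi_fredholm_def nullity_def cdim_less_infinity_iff by auto
  obtain p where p: "quotient_projection (range S) p" using range_projection by blast
  obtain m where "eventually_uniform_op S m" using eventually_uniform_if_finite_nullity[OF R N] by blast
  then have rm: "range (S ^^ Suc m) = range (S ^^ m)"
    using freq by (rule eventually_uniform_op.frequently_shift_surj_imp_finite_descent)
  then have pm: "p ` null_space (S ^^ m) = range p" using image_null_space_eq_iff[OF p] by blast
  have W: "finite_dim (range p)"
    unfolding pm[symmetric]
    by (rule finite_dim_image[OF quotient_projection_linear[OF p] finite_dim_null_space_funpow[OF N]])
  have nul: "nullity S = enat (cvs.dim (null_space S))"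
    unfolding nullity_def by (rule cdim_finite_dim[OF N])
  have "cvs.dim (null_space S) \<le> cvs.dim (range p)"
    using ind unfolding index_le_0_iff[OF nul] nul defect_eq[OF p] cdim_finite_dim[OF W] by simp
  then have "cvs.dim (null_space (S ^^ Suc m)) \<le> cvs.dim (null_space (S ^^ m))"
    using kernel_growth_balance[OF N p, of m] unfolding pm by simp
  then have "null_space (S ^^ m) = null_space (S ^^ Suc m)"
    by (intro finite_dim_subspace_eqI null_space_funpow_mono csubspace_null_space_funpow
        finite_dim_null_space_funpow N) auto
  then show ?thesis using browderI[OF R N p W _ rm] by simp
qed

text \<open>
  Injective operators arbitrarily close to \<open>S\<close> make the kernels stop growing.  Then \<open>N(S)\<close> meets
  \<open>R(S\<^sup>m)\<close>, a subspace of finite codimension, only in \<open>0\<close>; so the nullity is finite and the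
  dimension identity applies.
\<close>

theorem lower_semi_weyl_browder:
  assumes S: "lower_semi_weyl S" and freq: "\<exists>\<^sub>F e in at 0. inj (shift S e)"
  shows "browder S"
proof -
  obtain p where p: "quotient_projection (range S) p" using range_projection by blast
  have R: "closed (range S)" and W: "finite_dim (range p)" and ind: "index S \<ge> 0"
    using S unfolding lower_semi_weyl_def lower_semi_fredholm_def defect_eq[OF p] cdim_less_infinity_iff by auto
  obtain m where m: "eventually_uniform_op S m" using eventually_uniform_if_finite_defect[OF p W] by blast
  have nm: "null_space (S ^^ Suc m) = null_space (S ^^ m)"
    using freq eventually_uniform_op.infinite_ascent_imp_shift_not_inj[OF m]
    unfolding frequently_def by auto
  obtain q where q: "quotient_projection (range (S ^^ m)) q"
    using quotient_projection_exists[OF bounded_op.csubspace_range[OF bounded_op_funpow]] by blast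
  have N: "finite_dim (null_space S)"
  proof (rule finite_dim_from_kernel_image[OF quotient_projection_linear[OF q] csubspace_null_space])
    have "x = 0" if x: "x \<in> null_space S" "x \<in> range (S ^^ m)" for x
    proof -
      obtain y where y: "x = (S ^^ m) y" using x(2) by blast
      then have "y \<in> null_space (S ^^ Suc m)" using x(1) by (simp add: null_space_def)
      then show ?thesis unfolding nm using y by (simp add: null_space_def)
    qed
    then have "{x \<in> null_space S. q x = 0} \<subseteq> cvs.span {}"
      unfolding quotient_projection_eq_0_iff[OF q] by auto
    then show "finite_dim {x \<in> null_space S. q x = 0}"
      unfolding finite_dim_def by (intro exI[of _ "{}"]) simp
    show "finite_dim (q ` null_space S)"
      by (rule finite_dim_subset[OF finite_dim_range_funpow_projection[OF p W q]]) auto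
  qed
  have def: "defect S = enat (cvs.dim (range p))"
    unfolding defect_eq[OF p] by (rule cdim_finite_dim[OF W])
  have "cvs.dim (range p) \<le> cvs.dim (null_space S)"
    using ind unfolding index_ge_0_iff[OF def] def nullity_def cdim_finite_dim[OF N] by simp
  then have "cvs.dim (range p) \<le> cvs.dim (p ` null_space (S ^^ m))"
    using kernel_growth_balance[OF N p, of m] unfolding nm by simp
  then have "p ` null_space (S ^^ m) = range p"
    by (intro finite_dim_subspace_eqI W csubspace_range_quotient_projection[OF p]
        cvp.linear_subspace_image[OF quotient_projection_linear[OF p] csubspace_null_space_funpow]) auto
  then have "range (S ^^ Suc m) = range (S ^^ m)" using image_null_space_eq_iff[OF p] by blast
  then show ?thesis by (rule browderI[OF R N p W nm])
qed

end

section \<open>Spectra\<close>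

text \<open>
  A point outside the interior of \<open>C\<close> lies in the closure of the complement of \<open>C\<close>, and each point
  of this complement is surrounded by points with the property \<open>Q\<close>.
\<close>

lemma frequently_at_if_not_interior:
  fixes C :: "complex set"
  assumes Q: "\<And>w. w \<notin> C \<Longrightarrow> \<forall>\<^sub>F u in at w. Q u" and z: "z \<notin> interior C"
  shows "\<exists>\<^sub>F u in at z. Q u"
proof (rule ccontr)
  assume "\<not> ?thesis"
  then have "\<forall>\<^sub>F u in at z. \<not> Q u" by (simp add: frequently_def)
  then obtain U where U: "open U" "z \<in> U" "\<And>u. u \<in> U \<Longrightarrow> u \<noteq> z \<Longrightarrow> \<not> Q u"
    unfolding eventually_at_topological by blast
  have "U \<subseteq> C"
  proof (rule subsetI, rule ccontr)
    fix w assume w: "w \<in> U" "w \<notin> C"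
    have "\<forall>\<^sub>F u in at w. u \<in> U - {w}" by (rule eventually_at_in_open[OF U(1) w(1)])
    moreover have "\<forall>\<^sub>F u in at w. u \<noteq> z" by (rule eventually_neq_at_within)
    ultimately have "\<forall>\<^sub>F u in at w. False"
      using Q[OF w(2)] by eventually_elim (use U(3) in blast)
    then show False by simp
  qed
  then show False using U z interior_maximal by blast
qed

text \<open>
  A punctured disc around \<open>z\<close> that misses \<open>A\<close> is connected, and in it \<open>B\<close> coincides with the
  open set \<open>interior C\<close>; so \<open>B\<close> misses it or \<open>C\<close> contains it.  In the second case the
  hypothesis on the complement of \<open>C\<close> puts \<open>z\<close> into \<open>C\<close> as well.
\<close>

lemma isolated_points_subset:
  fixes A B C :: "complex set"
  assumes B: "closed B" "B = A \<union> interior C"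
    and C: "\<And>z. z \<notin> C \<Longrightarrow> \<forall>\<^sub>F w in at z. w \<notin> A \<longrightarrow> w \<notin> C"
  shows "isolated_points A \<subseteq> isolated_points B \<union> interior C"
proof
  fix z assume "z \<in> isolated_points A"
  then obtain r where zA: "z \<in> A" and r: "r > 0" "\<And>w. w \<in> A \<Longrightarrow> dist z w < r \<Longrightarrow> w = z"
    unfolding isolated_points_def isolated_in_dist_Ex_iff by blast
  define D where "D = ball z r - {z}"
  have DA: "D \<inter> A = {}" unfolding D_def using r(2) by auto
  have "connected D" unfolding D_def by (rule connected_punctured_ball) simp
  moreover have "D \<subseteq> interior C \<union> - B" using DA B(2) by blast
  moreover have "interior C \<inter> - B \<inter> D = {}" using B(2) by blast
  ultimately have "interior C \<inter> D = {} \<or> - B \<inter> D = {}"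
    using B(1) by (intro connectedD) auto
  then show "z \<in> isolated_points B \<union> interior C"
  proof
    assume "interior C \<inter> D = {}"
    then have "D \<inter> B = {}" using DA B(2) by blast
    then have "\<forall>w\<in>B. dist z w < r \<longrightarrow> w = z" unfolding D_def by auto
    then have "z \<in> isolated_points B"
      unfolding isolated_points_def isolated_in_dist_Ex_iff using zA r(1) B(2) by blast
    then show ?thesis by blast
  next
    assume "- B \<inter> D = {}"
    then have DC: "D \<subseteq> interior C" using DA B(2) by blast
    have "z \<in> C"
    proof (rule ccontr)
      assume "z \<notin> C"
      from C[OF this] have "\<forall>\<^sub>F w in at z. w \<notin> A \<longrightarrow> w \<notin> C" .
      moreover have "\<forall>\<^sub>F w in at z. w \<in> D"
        unfolding D_def using r(1) by (intro eventually_at_in_open) auto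
      ultimately have "\<forall>\<^sub>F w in at z. False"
        by eventually_elim (use DA DC interior_subset in blast)
      then show False by simp
    qed
    then have "ball z r \<subseteq> C" using DC interior_subset[of C] unfolding D_def by blast
    then have "z \<in> interior C" using r(1) by (intro interiorI[of "ball z r"]) auto
    then show ?thesis by blast
  qed
qed

context bounded_op
begin

lemma eventually_at_shift: "(\<forall>\<^sub>F w in at z. P (shift S w)) \<longleftrightarrow> (\<forall>\<^sub>F e in at 0. P (shift (shift S z) e))"
  unfolding eventually_at_to_0[of _ z] shift_shift by (simp add: add.commute)

lemma frequently_at_shift: "(\<exists>\<^sub>F w in at z. P (shift S w)) \<longleftrightarrow> (\<exists>\<^sub>F e in at 0. P (shift (shift S z) e))"
  unfolding frequently_def using eventually_at_shift[of "\<lambda>R. \<not> P R"] by simp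

lemma near_descent_resolvent: "z \<notin> \<sigma>\<^sub>d\<^sub>e\<^sub>s\<^sub>c S \<Longrightarrow> \<forall>\<^sub>F w in at z. range (shift S w) = UNIV"
  unfolding eventually_at_shift[of "\<lambda>R. range R = UNIV"] spectrum_desc_def
  using bounded_op.finite_descent_imp_shift_surj[OF bounded_op_shift]
    descent_finite_iff[of "shift S z"] by (auto simp del: funpow.simps)

lemma near_left_drazin_resolvent: "z \<notin> \<sigma>\<^sub>L\<^sub>D S \<Longrightarrow> \<forall>\<^sub>F w in at z. inj (shift S w)"
  unfolding eventually_at_shift[of inj] spectrum_LD_def
  using bounded_op.left_drazin_invertible_imp_shift_inj[OF bounded_op_shift] by auto

lemma near_browder_resolvent: "z \<notin> \<sigma>\<^sub>b S \<Longrightarrow> \<forall>\<^sub>F w in at z. w \<notin> \<sigma> S"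
  unfolding spectrum_b_def spectrum_def
  using eventually_at_shift[of invertible_op] bounded_op.browder_imp_shift_invertible[OF bounded_op_shift]
  by auto

lemma spectrum_b_subset: "\<sigma>\<^sub>b S \<subseteq> \<sigma> S"
  unfolding spectrum_b_def spectrum_def using bounded_op.invertible_imp_browder[OF bounded_op_shift] by blast

text \<open>
  Every point outside \<open>\<sigma>\<^sub>b S\<close> has a punctured neighbourhood outside \<open>\<sigma> S\<close>.  This yields the
  closedness of \<open>\<sigma> S\<close> and of \<open>\<sigma>\<^sub>b S\<close> at once.
\<close>

lemma closed_if_near_browder_resolvent:
  assumes "\<sigma>\<^sub>b S \<subseteq> B" "B \<subseteq> \<sigma> S"
  shows "closed B"
proof -
  have "\<exists>U. open U \<and> z \<in> U \<and> U \<subseteq> - B" if "z \<in> - B" for z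
  proof -
    have "z \<notin> \<sigma>\<^sub>b S" using that assms by blast
    then obtain U where "open U" "z \<in> U" "\<And>w. w \<in> U \<Longrightarrow> w \<noteq> z \<Longrightarrow> w \<notin> \<sigma> S"
      using near_browder_resolvent[of z] unfolding eventually_at_topological by blast
    then show ?thesis using that assms(2) by blast
  qed
  then show ?thesis unfolding closed_def by (subst open_subopen) blast
qed

lemma spectrum_b_upper: "\<sigma>\<^sub>b S = \<sigma>\<^sub>u\<^sub>w S \<union> interior (\<sigma>\<^sub>d\<^sub>e\<^sub>s\<^sub>c S)"
proof
  show "\<sigma>\<^sub>u\<^sub>w S \<union> interior (\<sigma>\<^sub>d\<^sub>e\<^sub>s\<^sub>c S) \<subseteq> \<sigma>\<^sub>b S"
    using bounded_op.browder_imp_semi_weyl(1)[OF bounded_op_shift] interior_subset[of "\<sigma>\<^sub>d\<^sub>e\<^sub>s\<^sub>c S"]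
    unfolding spectrum_b_def spectrum_uw_def spectrum_desc_def browder_def by force
  show "\<sigma>\<^sub>b S \<subseteq> \<sigma>\<^sub>u\<^sub>w S \<union> interior (\<sigma>\<^sub>d\<^sub>e\<^sub>s\<^sub>c S)"
  proof
    fix z assume z: "z \<in> \<sigma>\<^sub>b S"
    have "upper_semi_weyl (shift S z) \<Longrightarrow> z \<notin> interior (\<sigma>\<^sub>d\<^sub>e\<^sub>s\<^sub>c S) \<Longrightarrow> browder (shift S z)"
      using bounded_op.upper_semi_weyl_browder[OF bounded_op_shift]
        frequently_at_if_not_interior[OF near_descent_resolvent, where z = z]
      unfolding frequently_at_shift[of "\<lambda>R. range R = UNIV"] by blast
    then show "z \<in> \<sigma>\<^sub>u\<^sub>w S \<union> interior (\<sigma>\<^sub>d\<^sub>e\<^sub>s\<^sub>c S)"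
      using z unfolding spectrum_b_def spectrum_uw_def by blast
  qed
qed

lemma spectrum_b_lower: "\<sigma>\<^sub>b S = \<sigma>\<^sub>l\<^sub>w S \<union> interior (\<sigma>\<^sub>L\<^sub>D S)"
proof
  show "\<sigma>\<^sub>l\<^sub>w S \<union> interior (\<sigma>\<^sub>L\<^sub>D S) \<subseteq> \<sigma>\<^sub>b S"
    using bounded_op.browder_imp_semi_weyl(2)[OF bounded_op_shift] interior_subset[of "\<sigma>\<^sub>L\<^sub>D S"]
      bounded_op.browder_imp_left_drazin_invertible[OF bounded_op_shift]
    unfolding spectrum_b_def spectrum_lw_def spectrum_LD_def by auto
  show "\<sigma>\<^sub>b S \<subseteq> \<sigma>\<^sub>l\<^sub>w S \<union> interior (\<sigma>\<^sub>L\<^sub>D S)"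
  proof
    fix z assume z: "z \<in> \<sigma>\<^sub>b S"
    have "lower_semi_weyl (shift S z) \<Longrightarrow> z \<notin> interior (\<sigma>\<^sub>L\<^sub>D S) \<Longrightarrow> browder (shift S z)"
      using bounded_op.lower_semi_weyl_browder[OF bounded_op_shift]
        frequently_at_if_not_interior[OF near_left_drazin_resolvent, where z = z]
      unfolding frequently_at_shift[of inj] by blast
    then show "z \<in> \<sigma>\<^sub>l\<^sub>w S \<union> interior (\<sigma>\<^sub>L\<^sub>D S)"
      using z unfolding spectrum_b_def spectrum_lw_def by blast
  qed
qed

text \<open>
  A bounded below or surjective Browder operator is invertible, its nullity and defect being
  equal.  This reduces the formulas for \<open>\<sigma>\<close> to those for \<open>\<sigma>\<^sub>b\<close>.
\<close>

lemma spectrum_upper: "\<sigma> S = \<sigma>\<^sub>a\<^sub>p S \<union> interior (\<sigma>\<^sub>d\<^sub>e\<^sub>s\<^sub>c S)"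
proof
  show "\<sigma>\<^sub>a\<^sub>p S \<union> interior (\<sigma>\<^sub>d\<^sub>e\<^sub>s\<^sub>c S) \<subseteq> \<sigma> S"
  proof (rule Un_least)
    show "\<sigma>\<^sub>a\<^sub>p S \<subseteq> \<sigma> S"
      unfolding spectrum_ap_def spectrum_def bounded_below_def
      by (auto simp: bounded_op.invertible_op_iff[OF bounded_op_shift])
    show "interior (\<sigma>\<^sub>d\<^sub>e\<^sub>s\<^sub>c S) \<subseteq> \<sigma> S"
      using spectrum_b_upper spectrum_b_subset by blast
  qed
  show "\<sigma> S \<subseteq> \<sigma>\<^sub>a\<^sub>p S \<union> interior (\<sigma>\<^sub>d\<^sub>e\<^sub>s\<^sub>c S)"
  proof (rule subsetI, rule ccontr)
    fix z assume z: "z \<in> \<sigma> S" "z \<notin> \<sigma>\<^sub>a\<^sub>p S \<union> interior (\<sigma>\<^sub>d\<^sub>e\<^sub>s\<^sub>c S)"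
    interpret Sz: bounded_op "shift S z" by (rule bounded_op_shift)
    have bb: "inj (shift S z)" "closed (range (shift S z))"
      using z(2) unfolding spectrum_ap_def bounded_below_def by auto
    then have n0: "nullity (shift S z) = enat 0" using Sz.inj_iff_nullity by (simp add: zero_enat_def)
    then have "upper_semi_weyl (shift S z)"
      using bb(2) index_le_0_iff[OF n0] unfolding upper_semi_weyl_def upper_semi_fredholm_def
      by (simp flip: zero_enat_def)
    then have "browder (shift S z)"
      using z(2) spectrum_b_upper unfolding spectrum_b_def spectrum_uw_def by blast
    then have "range (shift S z) = UNIV"
      using Sz.browder_nullity_eq_defect n0 Sz.surj_iff_defect by (simp add: zero_enat_def)
    then show False using z(1) bb(1) Sz.invertible_op_iff unfolding spectrum_def by simp
  qed
qed

lemma spectrum_lower: "\<sigma> S = \<sigma>\<^sub>s\<^sub>u S \<union> interior (\<sigma>\<^sub>L\<^sub>D S)"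
proof
  show "\<sigma>\<^sub>s\<^sub>u S \<union> interior (\<sigma>\<^sub>L\<^sub>D S) \<subseteq> \<sigma> S"
  proof (rule Un_least)
    show "\<sigma>\<^sub>s\<^sub>u S \<subseteq> \<sigma> S"
      unfolding spectrum_su_def spectrum_def
      by (auto simp: bounded_op.invertible_op_iff[OF bounded_op_shift])
    show "interior (\<sigma>\<^sub>L\<^sub>D S) \<subseteq> \<sigma> S"
      using spectrum_b_lower spectrum_b_subset by blast
  qed
  show "\<sigma> S \<subseteq> \<sigma>\<^sub>s\<^sub>u S \<union> interior (\<sigma>\<^sub>L\<^sub>D S)"
  proof (rule subsetI, rule ccontr)
    fix z assume z: "z \<in> \<sigma> S" "z \<notin> \<sigma>\<^sub>s\<^sub>u S \<union> interior (\<sigma>\<^sub>L\<^sub>D S)"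
    interpret Sz: bounded_op "shift S z" by (rule bounded_op_shift)
    have sj: "range (shift S z) = UNIV"
      using z(2) unfolding spectrum_su_def by auto
    then have d0: "defect (shift S z) = enat 0" using Sz.surj_iff_defect by (simp add: zero_enat_def)
    then have "lower_semi_weyl (shift S z)"
      using sj index_ge_0_iff[OF d0] unfolding lower_semi_weyl_def lower_semi_fredholm_def
      by (simp flip: zero_enat_def)
    then have "browder (shift S z)"
      using z(2) spectrum_b_lower unfolding spectrum_b_def spectrum_lw_def by blast
    then have "inj (shift S z)"
      using Sz.browder_nullity_eq_defect d0 Sz.inj_iff_nullity by (simp add: zero_enat_def)
    then show False using z(1) sj Sz.invertible_op_iff unfolding spectrum_def by simp
  qed
qed

lemma near_descent_resolvent_not_desc: "z \<notin> \<sigma>\<^sub>d\<^sub>e\<^sub>s\<^sub>c S \<Longrightarrow> \<forall>\<^sub>F w in at z. w \<notin> A \<longrightarrow> w \<notin> \<sigma>\<^sub>d\<^sub>e\<^sub>s\<^sub>c S"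
  by (rule eventually_mono[OF near_descent_resolvent])
    (use bounded_op.surj_imp_finite_descent[OF bounded_op_shift] in \<open>auto simp: spectrum_desc_def\<close>)

lemma near_left_drazin_resolvent_not_LD:
  assumes "z \<notin> \<sigma>\<^sub>L\<^sub>D S" "\<And>w. w \<notin> A \<Longrightarrow> closed (range (shift S w))"
  shows "\<forall>\<^sub>F w in at z. w \<notin> A \<longrightarrow> w \<notin> \<sigma>\<^sub>L\<^sub>D S"
  by (rule eventually_mono[OF near_left_drazin_resolvent[OF assms(1)]])
    (use bounded_op.bounded_below_imp_left_drazin_invertible[OF bounded_op_shift] assms(2) in
      \<open>auto simp: spectrum_LD_def\<close>)

end

theorem theorem2p1:
  fixes T :: "'a :: complex_banach \<Rightarrow> 'a"
  assumes "cdim (UNIV :: 'a set) = \<infinity>"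
    and "bounded_operator T"
  shows "(isolated_points (\<sigma>\<^sub>a\<^sub>p T) \<subseteq> isolated_points (\<sigma> T) \<union> interior (\<sigma>\<^sub>d\<^sub>e\<^sub>s\<^sub>c T)) \<and>
         (isolated_points (\<sigma>\<^sub>s\<^sub>u T) \<subseteq> isolated_points (\<sigma> T) \<union> interior (\<sigma>\<^sub>L\<^sub>D T)) \<and>
         (isolated_points (\<sigma>\<^sub>u\<^sub>w T) \<subseteq> isolated_points (\<sigma>\<^sub>b T) \<union> interior (\<sigma>\<^sub>d\<^sub>e\<^sub>s\<^sub>c T)) \<and>
         (isolated_points (\<sigma>\<^sub>l\<^sub>w T) \<subseteq> isolated_points (\<sigma>\<^sub>b T) \<union> interior (\<sigma>\<^sub>L\<^sub>D T)) \<and>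
         (\<sigma> T = \<sigma>\<^sub>a\<^sub>p T \<union> interior (\<sigma>\<^sub>d\<^sub>e\<^sub>s\<^sub>c T)) \<and>
         (\<sigma> T = \<sigma>\<^sub>s\<^sub>u T \<union> interior (\<sigma>\<^sub>L\<^sub>D T)) \<and>
         (\<sigma>\<^sub>b T = \<sigma>\<^sub>u\<^sub>w T \<union> interior (\<sigma>\<^sub>d\<^sub>e\<^sub>s\<^sub>c T)) \<and>
         (\<sigma>\<^sub>b T = \<sigma>\<^sub>l\<^sub>w T \<union> interior (\<sigma>\<^sub>L\<^sub>D T))"
proof -
  interpret bounded_op T by unfold_locales (rule assms(2))
  have closed: "closed (\<sigma> T)" "closed (\<sigma>\<^sub>b T)"
    using spectrum_b_subset by (auto intro: closed_if_near_browder_resolvent)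
  have su: "closed (range (shift T w))" if "w \<notin> \<sigma>\<^sub>s\<^sub>u T" for w
    using that by (simp add: spectrum_su_def)
  have lw: "closed (range (shift T w))" if "w \<notin> \<sigma>\<^sub>l\<^sub>w T" for w
    using that by (simp add: spectrum_lw_def lower_semi_weyl_def lower_semi_fredholm_def)
  show ?thesis
    using isolated_points_subset[OF closed(1) spectrum_upper near_descent_resolvent_not_desc]
      isolated_points_subset[OF closed(1) spectrum_lower near_left_drazin_resolvent_not_LD[OF _ su]]
      isolated_points_subset[OF closed(2) spectrum_b_upper near_descent_resolvent_not_desc]
      isolated_points_subset[OF closed(2) spectrum_b_lower near_left_drazin_resolvent_not_LD[OF _ lw]]
      spectrum_upper spectrum_lower spectrum_b_upper spectrum_b_lower
    by (intro conjI)
qed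

end
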